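(* Let $V=\mathbb R^n$, let $\mathfrak g$ be a Lie subalgebra of $\mathrm{End}\,V$, and let $r\in\bigwedge^2\mathfrak g\subset\mathrm{End}\,V\otimes\mathrm{End}\,V$ be a classical $r$-matrix such that the brackets $\{x^j,x^k\}=\sum_{l,m}r^{jk}_{lm}x^lx^m$ on $V$ and $\{p_l,p_m\}=\sum_{j,k}p_jp_kr^{jk}_{lm}$ on $V^*$ satisfy the Jacobi identity. Let $s\in\mathfrak g\otimes\mathfrak g$ be a $\mathfrak g$-invariant symmetric element such that $w:=r+s$ satisfies the classical Yang–Baxter equation $[w_{12},w_{13}]+[w_{12},w_{23}]+[w_{13},w_{23}]=0$. (i) The brackets on $T^*V=V\times V^*$ $$\{x^j,x^k\}=\sum_{l,m}r^{jk}_{lm}x^lx^m,\qquad \{p_l,p_m\}=\sum_{j,k}p_jp_k\,r^{jk}_{lm},\qquad \{p_l,x^k\}=\delta_l^k-\sum_{j,m}p_j\,w^{jk}_{lm}\,x^m$$ satisfy the Jacobi identity if and only if $s^{jk}_{lm}=s^{kj}_{lm}$ for all $j,k,l,m$. (ii) For $\lambda\in\mathbb R$, the same brackets with $w$ replaced by $w_\lambda:=r+s+\lambda I\otimes I$ satisfy the Jacobi identity if and only if $(s_\lambda)^{jk}_{lm}=(s_\lambda)^{kj}_{lm}$ for all $j,k,l,m$, where $s_\lambda=s+\lambda I\otimes I$.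
   Context: $e_j{}^l$ are the matrix units in $\mathrm{End}\,V$ ($e_j{}^l x=x^le_j$), and components of an element $\rho\in\mathrm{End}\,V\otimes\mathrm{End}\,V$ are given by $\rho=\sum\rho^{jk}_{lm}e_j{}^l\otimes e_k{}^m$. $I$ is the identity of $\mathrm{End}\,V$. $x^j$ are the coordinates on $V$ and $p_j$ the dual coordinates on $V^*$. $\rho_{12},\rho_{13},\rho_{23}$ denote $\rho$ placed in the indicated factors of $(\mathrm{End}\,V)^{\otimes3}$. A classical $r$-matrix on $\mathfrak g$ is an $r\in\bigwedge^2\mathfrak g$ whose Schouten bracket $[r,r]\in\bigwedge^3\mathfrak g$ is $\mathfrak g$-invariant. Brackets of coordinates are extended to all smooth functions as a skew-symmetric biderivation. *)

theory Defs
  imports "HOL-Analysis.Analysis"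
begin

section \<open>Tensors over \<open>End V\<close>, \<open>V = real ^ 'n\<close>\<close>

text \<open>
  \<open>A $ j $ l\<close> is the component with upper index \<open>j\<close> and lower index \<open>l\<close> of \<open>A \<in> End V\<close>.
  \<open>End V \<otimes> End V\<close> is identified with \<open>End (V \<otimes> V)\<close>, and the component of \<open>\<rho>\<close> with upper
  indices \<open>j k\<close> and lower indices \<open>l m\<close> is \<open>\<rho> $ (j, k) $ (l, m)\<close>.  Similarly, triple tensors
  are matrices indexed by \<open>'n \<times> 'n \<times> 'n\<close>.  The product \<open>**\<close> of matrices is the product of the
  algebra \<open>(End V)\<^bsup>\<otimes>k\<^esup>\<close>.
\<close>

type_synonym 'n endo = "real ^ 'n ^ 'n"
type_synonym 'n endo2 = "real ^ ('n \<times> 'n) ^ ('n \<times> 'n)"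
type_synonym 'n endo3 = "real ^ ('n \<times> 'n \<times> 'n) ^ ('n \<times> 'n \<times> 'n)"

definition tensor ::
    "real ^ 'a ^ 'a \<Rightarrow> real ^ 'b ^ 'b \<Rightarrow> real ^ ('a::finite \<times> 'b::finite) ^ ('a \<times> 'b)"
    (infixr "\<otimes>" 75)
  where "A \<otimes> B = (\<chi> a b. A $ fst a $ fst b * B $ snd a $ snd b)"

abbreviation Id_endo :: "real ^ 'a ^ 'a::finite"  ("\<one>")
  where "\<one> \<equiv> mat 1"

text \<open>\<open>unit_mat j l\<close> maps \<open>x\<close> to \<open>x $ l\<close> times the \<open>j\<close>-th basis vector.\<close>

definition unit_mat :: "'n \<Rightarrow> 'n \<Rightarrow> 'n::finite endo"
  where "unit_mat j l = (\<chi> a b. if a = j \<and> b = l then 1 else 0)"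

definition commutator :: "real ^ 'a ^ 'a \<Rightarrow> real ^ 'a ^ 'a \<Rightarrow> real ^ 'a ^ 'a::finite"
  where "commutator A B = A ** B - B ** A"

definition wedge2 :: "'n endo \<Rightarrow> 'n endo \<Rightarrow> 'n::finite endo2"
  where "wedge2 A B = A \<otimes> B - B \<otimes> A"

definition wedge3 :: "'n endo \<Rightarrow> 'n endo \<Rightarrow> 'n endo \<Rightarrow> 'n::finite endo3"
  where "wedge3 A B C = A \<otimes> B \<otimes> C + B \<otimes> C \<otimes> A + C \<otimes> A \<otimes> B
                       - B \<otimes> A \<otimes> C - A \<otimes> C \<otimes> B - C \<otimes> B \<otimes> A"

definition lie_subalgebra :: "'n::finite endo set \<Rightarrow> bool"
  where "lie_subalgebra \<gg> \<longleftrightarrow> subspace \<gg> \<and> (\<forall>A\<in>\<gg>. \<forall>B\<in>\<gg>. commutator A B \<in> \<gg>)"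

definition tensor_square :: "'n endo set \<Rightarrow> 'n::finite endo2 set"
  where "tensor_square \<gg> = span {A \<otimes> B | A B. A \<in> \<gg> \<and> B \<in> \<gg>}"

definition exterior_square :: "'n endo set \<Rightarrow> 'n::finite endo2 set"
  where "exterior_square \<gg> = span {wedge2 A B | A B. A \<in> \<gg> \<and> B \<in> \<gg>}"

definition exterior_cube :: "'n endo set \<Rightarrow> 'n::finite endo3 set"
  where "exterior_cube \<gg> = span {wedge3 A B C | A B C. A \<in> \<gg> \<and> B \<in> \<gg> \<and> C \<in> \<gg>}"

definition symmetric_tensor :: "'n::finite endo2 \<Rightarrow> bool"
  where "symmetric_tensor \<rho> \<longleftrightarrow> (\<forall>j k l m. \<rho> $ (j, k) $ (l, m) = \<rho> $ (k, j) $ (m, l))"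

text \<open>
  The action of \<open>X\<close> on tensors extending \<open>ad X\<close> as a derivation of the tensor product is the
  commutator with \<open>X \<otimes> \<one> + \<one> \<otimes> X\<close> (see \<open>commutator_tensor\<close> below), respectively with
  \<open>X \<otimes> \<one> \<otimes> \<one> + \<one> \<otimes> X \<otimes> \<one> + \<one> \<otimes> \<one> \<otimes> X\<close>.
\<close>

definition invariant2 :: "'n endo set \<Rightarrow> 'n::finite endo2 \<Rightarrow> bool"
  where "invariant2 \<gg> \<rho> \<longleftrightarrow> (\<forall>X\<in>\<gg>. commutator (X \<otimes> \<one> + \<one> \<otimes> X) \<rho> = 0)"

definition invariant3 :: "'n endo set \<Rightarrow> 'n::finite endo3 \<Rightarrow> bool"
  where "invariant3 \<gg> \<theta> \<longleftrightarrow>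
    (\<forall>X\<in>\<gg>. commutator (X \<otimes> \<one> \<otimes> \<one> + \<one> \<otimes> X \<otimes> \<one> + \<one> \<otimes> \<one> \<otimes> X) \<theta> = 0)"

text \<open>
  The Schouten bracket of bivectors over the Lie algebra \<open>End V\<close> is the bilinear map given on
  decomposable elements by \<open>schouten_dec\<close> (see \<open>schouten_wedge2\<close>).  A skew tensor \<open>\<rho>\<close> is the sum
  of \<open>\<rho> $ (j, k) $ (l, m) / 2\<close> times \<open>wedge2 (unit_mat j l) (unit_mat k m)\<close>.  The bracket over a
  Lie subalgebra is the restriction.
\<close>

definition schouten_dec :: "'n endo \<Rightarrow> 'n endo \<Rightarrow> 'n endo \<Rightarrow> 'n endo \<Rightarrow> 'n::finite endo3"
  where "schouten_dec A B C D =
      wedge3 (commutator A C) B D - wedge3 (commutator A D) B C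
    - wedge3 (commutator B C) A D + wedge3 (commutator B D) A C"

definition schouten :: "'n endo2 \<Rightarrow> 'n endo2 \<Rightarrow> 'n::finite endo3"
  where "schouten \<rho> \<sigma> =
    (\<Sum>((j, k), (l, m))\<in>UNIV. \<Sum>((j', k'), (l', m'))\<in>UNIV.
      (\<rho> $ (j, k) $ (l, m) / 2 * (\<sigma> $ (j', k') $ (l', m') / 2)) *\<^sub>R
        schouten_dec (unit_mat j l) (unit_mat k m) (unit_mat j' l') (unit_mat k' m'))"

definition classical_r_matrix :: "'n endo set \<Rightarrow> 'n::finite endo2 \<Rightarrow> bool"
  where "classical_r_matrix \<gg> r \<longleftrightarrow>
    r \<in> exterior_square \<gg> \<and> schouten r r \<in> exterior_cube \<gg> \<and> invariant3 \<gg> (schouten r r)"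

definition place12 :: "'n endo2 \<Rightarrow> 'n::finite endo3"
  where "place12 \<rho> = (\<Sum>((j, k), (l, m))\<in>UNIV.
    \<rho> $ (j, k) $ (l, m) *\<^sub>R (unit_mat j l \<otimes> unit_mat k m \<otimes> \<one>))"

definition place13 :: "'n endo2 \<Rightarrow> 'n::finite endo3"
  where "place13 \<rho> = (\<Sum>((j, k), (l, m))\<in>UNIV.
    \<rho> $ (j, k) $ (l, m) *\<^sub>R (unit_mat j l \<otimes> \<one> \<otimes> unit_mat k m))"

definition place23 :: "'n endo2 \<Rightarrow> 'n::finite endo3"
  where "place23 \<rho> = (\<Sum>((j, k), (l, m))\<in>UNIV.
    \<rho> $ (j, k) $ (l, m) *\<^sub>R (\<one> \<otimes> unit_mat j l \<otimes> unit_mat k m))"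

definition classical_Yang_Baxter :: "'n::finite endo2 \<Rightarrow> bool"
  where "classical_Yang_Baxter w \<longleftrightarrow>
    commutator (place12 w) (place13 w) + commutator (place12 w) (place23 w)
      + commutator (place13 w) (place23 w) = 0"


section \<open>Brackets of smooth functions\<close>

definition partial :: "'a::real_normed_vector \<Rightarrow> ('a \<Rightarrow> real) \<Rightarrow> 'a \<Rightarrow> real"
  where "partial v f z = frechet_derivative f (at z) v"

primrec C_k :: "nat \<Rightarrow> ('a::euclidean_space \<Rightarrow> real) \<Rightarrow> bool"
  where
    "C_k 0 f \<longleftrightarrow> continuous_on UNIV f"
  | "C_k (Suc k) f \<longleftrightarrow> (\<forall>z. f differentiable (at z)) \<and> (\<forall>v. C_k k (partial v f))"

definition smooth :: "('a::euclidean_space \<Rightarrow> real) \<Rightarrow> bool"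
  where "smooth f \<longleftrightarrow> (\<forall>k. C_k k f)"

text \<open>
  \<open>e\<close> is a basis of the space, indexed by \<open>'i\<close>, and \<open>\<pi> a b\<close> is the prescribed bracket of the
  coordinate functions number \<open>a\<close> and \<open>b\<close> of this basis.  \<open>biderivation e \<pi>\<close> is the extension of
  these brackets to functions as a biderivation; it is skew-symmetric if \<open>\<pi>\<close> is.
\<close>

definition biderivation ::
    "('i::finite \<Rightarrow> 'a::euclidean_space) \<Rightarrow> ('i \<Rightarrow> 'i \<Rightarrow> 'a \<Rightarrow> real) \<Rightarrow>
      ('a \<Rightarrow> real) \<Rightarrow> ('a \<Rightarrow> real) \<Rightarrow> 'a \<Rightarrow> real"
  where "biderivation e \<pi> f g z =
    (\<Sum>a\<in>UNIV. \<Sum>b\<in>UNIV. \<pi> a b z * partial (e a) f z * partial (e b) g z)"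

definition jacobi_identity ::
    "(('a::euclidean_space \<Rightarrow> real) \<Rightarrow> ('a \<Rightarrow> real) \<Rightarrow> 'a \<Rightarrow> real) \<Rightarrow> bool"
  where "jacobi_identity br \<longleftrightarrow>
    (\<forall>f g h. smooth f \<longrightarrow> smooth g \<longrightarrow> smooth h \<longrightarrow>
      (\<forall>z. br f (br g h) z + br g (br h f) z + br h (br f g) z = 0))"

definition coord_bracket_V :: "'n endo2 \<Rightarrow> 'n \<Rightarrow> 'n \<Rightarrow> real ^ 'n::finite \<Rightarrow> real"
  where "coord_bracket_V r j k x = (\<Sum>l\<in>UNIV. \<Sum>m\<in>UNIV. r $ (j, k) $ (l, m) * x $ l * x $ m)"

text \<open>\<open>V\<^sup>*\<close> is represented by the vectors \<open>p\<close> of dual coordinates.\<close>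

definition coord_bracket_dual :: "'n endo2 \<Rightarrow> 'n \<Rightarrow> 'n \<Rightarrow> real ^ 'n::finite \<Rightarrow> real"
  where "coord_bracket_dual r l m p = (\<Sum>j\<in>UNIV. \<Sum>k\<in>UNIV. p $ j * p $ k * r $ (j, k) $ (l, m))"

definition coord_bracket_px :: "'n endo2 \<Rightarrow> 'n \<Rightarrow> 'n \<Rightarrow> (real ^ 'n) \<times> (real ^ 'n::finite) \<Rightarrow> real"
  where "coord_bracket_px w l k = (\<lambda>(x, p).
    (if l = k then 1 else 0) - (\<Sum>j\<in>UNIV. \<Sum>m\<in>UNIV. p $ j * w $ (j, k) $ (l, m) * x $ m))"

text \<open>
  On \<open>T\<^sup>*V = V \<times> V\<^sup>*\<close>, with points \<open>(x, p)\<close>, the index \<open>Inl j\<close> stands for the coordinate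
  function \<open>x $ j\<close> and \<open>Inr l\<close> for \<open>p $ l\<close>.
\<close>

fun cotangent_basis :: "'n + 'n \<Rightarrow> (real ^ 'n) \<times> (real ^ 'n::finite)"
  where
    "cotangent_basis (Inl j) = (axis j 1, 0)"
  | "cotangent_basis (Inr l) = (0, axis l 1)"

fun coord_bracket_cotangent ::
    "'n endo2 \<Rightarrow> 'n endo2 \<Rightarrow> 'n + 'n \<Rightarrow> 'n + 'n \<Rightarrow> (real ^ 'n) \<times> (real ^ 'n::finite) \<Rightarrow> real"
  where
    "coord_bracket_cotangent r w (Inl j) (Inl k) (x, p) = coord_bracket_V r j k x"
  | "coord_bracket_cotangent r w (Inr l) (Inr m) (x, p) = coord_bracket_dual r l m p"
  | "coord_bracket_cotangent r w (Inr l) (Inl k) (x, p) = coord_bracket_px w l k (x, p)"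
  | "coord_bracket_cotangent r w (Inl k) (Inr l) (x, p) = - coord_bracket_px w l k (x, p)"

definition bracket_V ::
    "'n endo2 \<Rightarrow> (real ^ 'n \<Rightarrow> real) \<Rightarrow> (real ^ 'n \<Rightarrow> real) \<Rightarrow> real ^ 'n::finite \<Rightarrow> real"
  where "bracket_V r = biderivation (\<lambda>j. axis j 1) (coord_bracket_V r)"

definition bracket_dual ::
    "'n endo2 \<Rightarrow> (real ^ 'n \<Rightarrow> real) \<Rightarrow> (real ^ 'n \<Rightarrow> real) \<Rightarrow> real ^ 'n::finite \<Rightarrow> real"
  where "bracket_dual r = biderivation (\<lambda>l. axis l 1) (coord_bracket_dual r)"

definition bracket_cotangent ::
    "'n endo2 \<Rightarrow> 'n endo2 \<Rightarrow> ((real ^ 'n) \<times> (real ^ 'n) \<Rightarrow> real) \<Rightarrow>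
      ((real ^ 'n) \<times> (real ^ 'n) \<Rightarrow> real) \<Rightarrow> (real ^ 'n) \<times> (real ^ 'n::finite) \<Rightarrow> real"
  where "bracket_cotangent r w = biderivation cotangent_basis (coord_bracket_cotangent r w)"


section \<open>Consistency of the definitions\<close>

lemma tensor_mult: "(A \<otimes> B) ** (C \<otimes> D) = (A ** C) \<otimes> (B ** D)"
proof -
  have "(\<Sum>k\<in>UNIV. A $ a $ fst k * B $ b $ snd k * (C $ fst k $ c * D $ snd k $ d))
      = (\<Sum>i\<in>UNIV. A $ a $ i * C $ i $ c) * (\<Sum>i\<in>UNIV. B $ b $ i * D $ i $ d)" for a b c d
    unfolding sum_product sum.cartesian_product UNIV_Times_UNIV
    by (rule sum.cong) (auto simp: algebra_simps)
  then show ?thesis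
    by (simp add: vec_eq_iff tensor_def matrix_matrix_mult_def)
qed

lemma bilinear_tensor: "bilinear (\<otimes>)"
  unfolding bilinear_def
  by (auto intro!: linearI simp: tensor_def vec_eq_iff algebra_simps)

lemma bilinear_commutator: "bilinear commutator"
  unfolding bilinear_def
  by (auto intro!: linearI
      simp: commutator_def matrix_matrix_mult_def vec_eq_iff algebra_simps sum.distrib
        sum_distrib_left sum_subtractf)

lemma commutator_tensor:
  "commutator (X \<otimes> \<one> + \<one> \<otimes> X) (A \<otimes> B) = commutator X A \<otimes> B + A \<otimes> commutator X B"
proof -
  have "commutator (X \<otimes> \<one> + \<one> \<otimes> X) (A \<otimes> B)
      = commutator (X \<otimes> \<one>) (A \<otimes> B) + commutator (\<one> \<otimes> X) (A \<otimes> B)"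
    by (rule bilinear_ladd[OF bilinear_commutator])
  also have "\<dots> = commutator X A \<otimes> B + A \<otimes> commutator X B"
    by (simp add: commutator_def tensor_mult bilinear_lsub[OF bilinear_tensor]
        bilinear_rsub[OF bilinear_tensor])
  finally show ?thesis .
qed

lemma unit_mat_expand: "A = (\<Sum>(j, l)\<in>UNIV. A $ j $ l *\<^sub>R unit_mat j l)"
proof -
  have "(\<Sum>(j, l)\<in>UNIV. A $ j $ l * (if a = j \<and> b = l then 1 else 0)) = A $ a $ b" for a b
  proof -
    have "(\<Sum>(j, l)\<in>UNIV. A $ j $ l * (if a = j \<and> b = l then 1 else 0))
        = (\<Sum>q\<in>UNIV. if (a, b) = q then A $ fst q $ snd q else 0)"
      by (rule sum.cong) (auto split: if_splits)
    then show ?thesis by simp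
  qed
  then show ?thesis by (simp add: vec_eq_iff unit_mat_def case_prod_beta)
qed

lemma bilinear_unit_mat_expand:
  assumes "bilinear h"
  shows "(\<Sum>((j, k), (l, m))\<in>UNIV. (A \<otimes> B) $ (j, k) $ (l, m) *\<^sub>R h (unit_mat j l) (unit_mat k m))
    = h A B"
proof -
  have "h A B = h (\<Sum>q\<in>UNIV. A $ fst q $ snd q *\<^sub>R unit_mat (fst q) (snd q))
                  (\<Sum>q\<in>UNIV. B $ fst q $ snd q *\<^sub>R unit_mat (fst q) (snd q))"
    using unit_mat_expand[of A] unit_mat_expand[of B] by (simp add: case_prod_beta)
  also have "\<dots> = (\<Sum>(q, q')\<in>UNIV. (A $ fst q $ snd q * B $ fst q' $ snd q') *\<^sub>R
      h (unit_mat (fst q) (snd q)) (unit_mat (fst q') (snd q')))"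
    by (simp add: bilinear_sum[OF assms] bilinear_lmul[OF assms] bilinear_rmul[OF assms]
        case_prod_beta mult.commute)
  also have "\<dots> = (\<Sum>((j, k), (l, m))\<in>UNIV.
      (A \<otimes> B) $ (j, k) $ (l, m) *\<^sub>R h (unit_mat j l) (unit_mat k m))"
    by (rule sum.reindex_bij_witness[where
          i = "\<lambda>((j, k), (l, m)). ((j, l), (k, m))" and j = "\<lambda>((j, l), (k, m)). ((j, k), (l, m))"])
      (auto simp: tensor_def)
  finally show ?thesis by simp
qed

lemma place12_tensor: "place12 (A \<otimes> B) = A \<otimes> B \<otimes> \<one>"
  unfolding place12_def
  by (rule bilinear_unit_mat_expand)
    (auto simp: bilinear_def tensor_def vec_eq_iff algebra_simps intro!: linearI)

lemma place13_tensor: "place13 (A \<otimes> B) = A \<otimes> \<one> \<otimes> B"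
  unfolding place13_def
  by (rule bilinear_unit_mat_expand)
    (auto simp: bilinear_def tensor_def vec_eq_iff algebra_simps intro!: linearI)

lemma place23_tensor: "place23 (A \<otimes> B) = \<one> \<otimes> A \<otimes> B"
  unfolding place23_def
  by (rule bilinear_unit_mat_expand)
    (auto simp: bilinear_def tensor_def vec_eq_iff algebra_simps intro!: linearI)

lemma alternating_unit_mat_expand:
  fixes h :: "'n endo \<Rightarrow> 'n::finite endo \<Rightarrow> 'n endo3"
  assumes h: "bilinear h" and alt: "\<And>A B. h B A = - h A B"
  shows "(\<Sum>((j, k), (l, m))\<in>UNIV.
      (wedge2 A B $ (j, k) $ (l, m) / 2) *\<^sub>R h (unit_mat j l) (unit_mat k m)) = h A B"
proof -
  have "(\<Sum>((j, k), (l, m))\<in>UNIV.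
      (wedge2 A B $ (j, k) $ (l, m) / 2) *\<^sub>R h (unit_mat j l) (unit_mat k m))
    = (1/2) *\<^sub>R (h A B - h B A)"
  proof -
    have "(1/2) *\<^sub>R (S - T) = (1/2) *\<^sub>R (h A B - h B A)"
      if "S = h A B" "T = h B A" for S T
      using that by simp
    note * = this[OF bilinear_unit_mat_expand[OF h, of A B] bilinear_unit_mat_expand[OF h, of B A]]
    show ?thesis
      unfolding *[symmetric] sum_subtractf[symmetric] scaleR_sum_right
      by (rule sum.cong) (auto simp: wedge2_def algebra_simps diff_divide_distrib)
  qed
  also have "\<dots> = h A B"
    using alt[of B A] by (simp flip: scaleR_2)
  finally show ?thesis .
qed

lemmas tensor_distribs =
  bilinear_ladd[OF bilinear_tensor] bilinear_radd[OF bilinear_tensor]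
  bilinear_lsub[OF bilinear_tensor] bilinear_rsub[OF bilinear_tensor]
  bilinear_lmul[OF bilinear_tensor] bilinear_rmul[OF bilinear_tensor]
  bilinear_ladd[OF bilinear_commutator] bilinear_radd[OF bilinear_commutator]
  bilinear_lmul[OF bilinear_commutator] bilinear_rmul[OF bilinear_commutator]

lemma bilinear_schouten_dec_left: "bilinear (\<lambda>A B. schouten_dec A B C D)"
  unfolding bilinear_def
  by (auto intro!: linearI simp: schouten_dec_def wedge3_def tensor_distribs algebra_simps)

lemma bilinear_schouten_dec_right: "bilinear (\<lambda>C D. schouten_dec A B C D)"
  unfolding bilinear_def
  by (auto intro!: linearI simp: schouten_dec_def wedge3_def tensor_distribs algebra_simps)

lemma schouten_dec_alternating:
  "schouten_dec B A C D = - schouten_dec A B C D" "schouten_dec A B D C = - schouten_dec A B C D"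
  by (simp_all add: schouten_dec_def wedge3_def)

lemma schouten_wedge2: "schouten (wedge2 A B) (wedge2 C D) = schouten_dec A B C D"
proof -
  have "schouten (wedge2 A B) (wedge2 C D) =
    (\<Sum>((j, k), (l, m))\<in>UNIV. (wedge2 A B $ (j, k) $ (l, m) / 2) *\<^sub>R
      (\<Sum>((j', k'), (l', m'))\<in>UNIV. (wedge2 C D $ (j', k') $ (l', m') / 2) *\<^sub>R
        schouten_dec (unit_mat j l) (unit_mat k m) (unit_mat j' l') (unit_mat k' m')))"
    unfolding schouten_def scaleR_sum_right by (simp add: case_prod_beta)
  also have "\<dots> = schouten_dec A B C D"
    unfolding alternating_unit_mat_expand[OF bilinear_schouten_dec_right schouten_dec_alternating(2)]
    by (rule alternating_unit_mat_expand[OF bilinear_schouten_dec_left schouten_dec_alternating(1)])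
  finally show ?thesis .
qed

lemma biderivation_skew:
  assumes "\<And>a b z. \<pi> a b z = - \<pi> b a z"
  shows "biderivation e \<pi> f g z = - biderivation e \<pi> g f z"
proof -
  have "biderivation e \<pi> g f z
      = (\<Sum>b\<in>UNIV. \<Sum>a\<in>UNIV. \<pi> a b z * partial (e a) g z * partial (e b) f z)"
    unfolding biderivation_def by (rule sum.swap)
  also have "\<dots> = - biderivation e \<pi> f g z"
    unfolding biderivation_def sum_negf[symmetric]
    by (intro sum.cong refl) (subst assms, simp)
  finally show ?thesis by simp
qed

lemma biderivation_Leibniz:
  assumes "smooth f" "smooth g"
  shows "biderivation e \<pi> h (\<lambda>z. f z * g z) z
       = f z * biderivation e \<pi> h g z + biderivation e \<pi> h f z * g z"
proof -
  have d: "f differentiable (at z)" "g differentiable (at z)"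
    using assms[unfolded smooth_def, rule_format, of "Suc 0"] by simp_all
  have "((\<lambda>z. f z * g z) has_derivative
      (\<lambda>v. f z * frechet_derivative g (at z) v + frechet_derivative f (at z) v * g z)) (at z)"
    using d unfolding frechet_derivative_works by (rule has_derivative_mult)
  then have "partial v (\<lambda>z. f z * g z) z = f z * partial v g z + partial v f z * g z" for v
    unfolding partial_def by (simp add: frechet_derivative_at[symmetric])
  then show ?thesis
    unfolding biderivation_def
    by (simp add: algebra_simps sum.distrib sum_distrib_left)
qed

lemma bracket_cotangent_coordinates:
  fixes r w :: "'n::finite endo2"
  shows
  "bracket_cotangent r w (\<lambda>z. fst z $ j) (\<lambda>z. fst z $ k) (x, p)
     = (\<Sum>l\<in>UNIV. \<Sum>m\<in>UNIV. r $ (j, k) $ (l, m) * x $ l * x $ m)"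
  "bracket_cotangent r w (\<lambda>z. snd z $ l) (\<lambda>z. snd z $ m) (x, p)
     = (\<Sum>j\<in>UNIV. \<Sum>k\<in>UNIV. p $ j * p $ k * r $ (j, k) $ (l, m))"
  "bracket_cotangent r w (\<lambda>z. snd z $ l) (\<lambda>z. fst z $ k) (x, p)
     = (if l = k then 1 else 0) - (\<Sum>j\<in>UNIV. \<Sum>m\<in>UNIV. p $ j * w $ (j, k) $ (l, m) * x $ m)"
proof -
  have 1: "partial (cotangent_basis a) (\<lambda>z. fst z $ j) z = (if a = Inl j then 1 else 0)"
    for a and j :: 'n and z
  proof -
    have "((\<lambda>z::(real^'n) \<times> (real^'n). fst z $ j) has_derivative (\<lambda>z. fst z $ j)) (at z)"
      by (intro derivative_intros bounded_linear.has_derivative[OF bounded_linear_vec_nth] has_derivative_ident)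
    then show ?thesis
      unfolding partial_def by (cases a) (auto simp: frechet_derivative_at[symmetric] axis_def)
  qed
  have 2: "partial (cotangent_basis a) (\<lambda>z. snd z $ l) z = (if a = Inr l then 1 else 0)"
    for a and l :: 'n and z
  proof -
    have "((\<lambda>z::(real^'n) \<times> (real^'n). snd z $ l) has_derivative (\<lambda>z. snd z $ l)) (at z)"
      by (intro derivative_intros bounded_linear.has_derivative[OF bounded_linear_vec_nth] has_derivative_ident)
    then show ?thesis
      unfolding partial_def by (cases a) (auto simp: frechet_derivative_at[symmetric] axis_def)
  qed
  have 3: "(\<Sum>a\<in>UNIV. \<Sum>b\<in>UNIV. \<pi> a b * (if a = c then 1 else 0) * (if b = d then 1 else 0))
      = (\<pi> c d :: real)" for \<pi> and c d :: "'n + 'n"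
  proof -
    have "(\<Sum>a\<in>UNIV. \<Sum>b\<in>UNIV. \<pi> a b * (if a = c then 1 else 0) * (if b = d then 1 else 0))
        = (\<Sum>a\<in>UNIV. if a = c then \<pi> a d else 0)"
      by (rule sum.cong[OF refl]) (simp add: if_distrib cong: if_cong)
    then show ?thesis by simp
  qed
  show "bracket_cotangent r w (\<lambda>z. fst z $ j) (\<lambda>z. fst z $ k) (x, p)
     = (\<Sum>l\<in>UNIV. \<Sum>m\<in>UNIV. r $ (j, k) $ (l, m) * x $ l * x $ m)"
    "bracket_cotangent r w (\<lambda>z. snd z $ l) (\<lambda>z. snd z $ m) (x, p)
     = (\<Sum>j\<in>UNIV. \<Sum>k\<in>UNIV. p $ j * p $ k * r $ (j, k) $ (l, m))"
    "bracket_cotangent r w (\<lambda>z. snd z $ l) (\<lambda>z. fst z $ k) (x, p)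
     = (if l = k then 1 else 0) - (\<Sum>j\<in>UNIV. \<Sum>m\<in>UNIV. p $ j * w $ (j, k) $ (l, m) * x $ m)"
    unfolding bracket_cotangent_def biderivation_def 1 2 3
    by (simp_all add: coord_bracket_V_def coord_bracket_dual_def coord_bracket_px_def)
qed

end

theory Submission
  imports Defs
begin

text \<open>
  On smooth functions the Jacobi identity is equivalent to the vanishing of the Jacobiator of the
  coordinate functions: the terms with second derivatives cancel because these are symmetric.
  For one momentum and two positions, the cubic part of the Jacobiator is
  \<open>[w\<^sub>1\<^sub>2, w\<^sub>1\<^sub>3] + [w\<^sub>1\<^sub>2, r\<^sub>2\<^sub>3] + [w\<^sub>1\<^sub>3, r\<^sub>2\<^sub>3]\<close> contracted with \<open>p\<close> in the first factor and \<open>x\<close> in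
  the other two.  By the Yang--Baxter equation it equals \<open>- [w\<^sub>1\<^sub>2 + w\<^sub>1\<^sub>3, s\<^sub>2\<^sub>3]\<close>, which is zero
  by invariance of \<open>s\<close>.  The remaining linear part is the obstruction
  \<open>s\<^bsup>ba\<^esup>\<^bsub>lm\<^esub> - s\<^bsup>ab\<^esup>\<^bsub>lm\<^esub>\<close>.  Two momenta and one position are dual to this, and adding a multiple of
  \<open>\<one> \<otimes> \<one>\<close> changes no commutator.
\<close>

section \<open>The Jacobi identity in coordinates\<close>

lemma has_derivative_partial:
  assumes "f differentiable (at z)"
  shows "(f has_derivative (\<lambda>v. partial v f z)) (at z)"
  using assms unfolding partial_def frechet_derivative_works by simp

lemma partial_eqI:
  assumes "(f has_derivative D) (at z)"
  shows "partial v f z = D v"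
  using frechet_derivative_at[OF assms] by (simp add: partial_def)

lemma smooth_differentiable: "smooth f \<Longrightarrow> f differentiable (at z)"
  unfolding smooth_def by (metis C_k.simps(2))

lemma smooth_partial: "smooth f \<Longrightarrow> smooth (partial v f)"
  unfolding smooth_def by (metis C_k.simps(2))

lemma smooth_continuous: "smooth f \<Longrightarrow> continuous_on UNIV f"
  unfolding smooth_def by (metis C_k.simps(1))

lemma smooth_const: "smooth (\<lambda>z::'a::euclidean_space. c)"
proof -
  have "C_k k (\<lambda>z::'a. c)" for k and c :: real
  proof (induction k arbitrary: c)
    case (Suc k)
    have "partial v (\<lambda>z. c) = (\<lambda>z. 0)" for v :: 'a
      by (intro ext partial_eqI[where D = "\<lambda>_. 0"]) simp
    then show ?case using Suc[of 0] by auto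
  qed simp
  then show ?thesis by (simp add: smooth_def)
qed

text \<open>The first partial derivatives are constant. This makes the coordinate functions
  admissible as test functions in \<open>jacobi_identity\<close>.\<close>

lemma smooth_bounded_linear:
  assumes "bounded_linear f"
  shows "smooth f"
proof -
  have D: "(f has_derivative f) (at z)" for z
    by (rule bounded_linear_imp_has_derivative[OF assms])
  have "partial v f = (\<lambda>z. f v)" for v
    by (auto intro: partial_eqI D)
  then have "C_k k f" for k
    using D smooth_const[unfolded smooth_def]
    by (cases k) (auto simp: differentiable_def intro: linear_continuous_on[OF assms])
  then show ?thesis by (simp add: smooth_def)
qed

text \<open>Turns a directional derivative into a derivative in one real variable, to which the mean
  value theorem \<open>MVT2\<close> applies.\<close>

lemma line_has_derivative:
  assumes "f differentiable (at (z + t *\<^sub>R u))"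
  shows "((\<lambda>t. f (z + t *\<^sub>R u)) has_real_derivative partial u f (z + t *\<^sub>R u)) (at t)"
proof -
  have "((\<lambda>t. z + t *\<^sub>R u) has_derivative (\<lambda>t. t *\<^sub>R u)) (at t)"
    by (auto intro!: derivative_eq_intros)
  from diff_chain_at[OF this has_derivative_partial[OF assms]]
  have *: "((\<lambda>t. f (z + t *\<^sub>R u)) has_derivative (\<lambda>s. partial (s *\<^sub>R u) f (z + t *\<^sub>R u))) (at t)"
    by (simp add: o_def)
  have "partial (s *\<^sub>R u) f (z + t *\<^sub>R u) = partial u f (z + t *\<^sub>R u) * s" for s
    using linear_scale[OF has_derivative_linear[OF has_derivative_partial[OF assms]]] by simp
  with * show ?thesis by (simp add: has_field_derivative_def)
qed

text \<open>Two mean value steps, first along \<open>u\<close>, then along \<open>v\<close>.\<close>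

lemma second_difference:
  assumes f: "\<And>z. f differentiable (at z)" and g: "\<And>z. partial u f differentiable (at z)"
    and h: "0 < h"
  shows "\<exists>s t. 0 < s \<and> s < h \<and> 0 < t \<and> t < h \<and>
    f (z + h *\<^sub>R u + h *\<^sub>R v) - f (z + h *\<^sub>R u) - f (z + h *\<^sub>R v) + f z
      = h * h * partial v (partial u f) (z + s *\<^sub>R u + t *\<^sub>R v)"
proof -
  let ?g = "\<lambda>s. f ((z + h *\<^sub>R v) + s *\<^sub>R u) - f (z + s *\<^sub>R u)"
  have "(?g has_real_derivative
      partial u f ((z + h *\<^sub>R v) + s *\<^sub>R u) - partial u f (z + s *\<^sub>R u)) (at s)" for s
    by (intro DERIV_diff line_has_derivative f)
  from MVT2[OF h, of ?g, OF this]
  obtain s where s: "0 < s" "s < h"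
    "?g h - ?g 0 = h * (partial u f ((z + h *\<^sub>R v) + s *\<^sub>R u) - partial u f (z + s *\<^sub>R u))"
    by auto
  from MVT2[OF h, of "\<lambda>t. partial u f ((z + s *\<^sub>R u) + t *\<^sub>R v)", OF line_has_derivative[OF g]]
  obtain t where t: "0 < t" "t < h"
    "partial u f ((z + s *\<^sub>R u) + h *\<^sub>R v) - partial u f (z + s *\<^sub>R u)
      = h * partial v (partial u f) ((z + s *\<^sub>R u) + t *\<^sub>R v)"
    by auto
  have "z + h *\<^sub>R v + s *\<^sub>R u = z + s *\<^sub>R u + h *\<^sub>R v" "z + h *\<^sub>R v + h *\<^sub>R u = z + h *\<^sub>R u + h *\<^sub>R v"
    by (simp_all add: algebra_simps)
  with s t show ?thesis
    by (intro exI[of _ s] exI[of _ t]) auto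
qed

text \<open>The second difference of \<open>f\<close> is symmetric in \<open>u\<close> and
  \<open>v\<close>, and it is \<open>h * h\<close> times either mixed derivative at some point near
  \<open>z\<close>. If the two derivatives differed at \<open>z\<close>, continuity would keep them
  apart at these points.\<close>

lemma partial_commute:
  assumes f: "smooth f"
  shows "partial u (partial v f) z = partial v (partial u f) z"
proof (rule ccontr)
  let ?A = "partial v (partial u f)" and ?B = "partial u (partial v f)"
  assume "?B z \<noteq> ?A z"
  \<comment> \<open>Half the gap, so that the intervals of radius \<open>e\<close> around the two
    values are disjoint.\<close>
  define e where "e = \<bar>?A z - ?B z\<bar> / 2"
  have e: "e > 0" using \<open>?B z \<noteq> ?A z\<close> by (simp add: e_def)
  have "isCont ?A z" "isCont ?B z"
    using smooth_continuous[OF smooth_partial[OF smooth_partial[OF f]]]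
    by (auto simp: continuous_on_eq_continuous_at)
  then obtain d1 d2 where d: "d1 > 0" "d2 > 0"
    "\<And>y. dist y z < d1 \<Longrightarrow> dist (?A y) (?A z) < e" "\<And>y. dist y z < d2 \<Longrightarrow> dist (?B y) (?B z) < e"
    using e unfolding continuous_at_eps_delta by metis
  \<comment> \<open>So small that the whole parallelogram of side \<open>h\<close> lies in both
    neighbourhoods; the \<open>1\<close> keeps the denominator positive for
    \<open>u = v = 0\<close>.\<close>
  define h where "h = min d1 d2 / (norm u + norm v + 1)"
  have n: "norm u + norm v + 1 > 0"
    by (smt (verit) norm_ge_zero)
  then have h: "h > 0" using d by (simp add: h_def)
  have close: "dist (z + s *\<^sub>R a + t *\<^sub>R b) z < min d1 d2"
    if "0 < s" "s < h" "0 < t" "t < h" "norm a + norm b = norm u + norm v" for s t a b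
  proof -
    have "dist (z + s *\<^sub>R a + t *\<^sub>R b) z \<le> s * norm a + t * norm b"
      using norm_triangle_ineq[of "s *\<^sub>R a" "t *\<^sub>R b"] that by (simp add: dist_norm add.assoc)
    also have "\<dots> \<le> h * norm a + h * norm b"
      using that by (intro add_mono mult_right_mono) auto
    also have "\<dots> = h * (norm u + norm v)" using that by (simp flip: distrib_left)
    also have "\<dots> < h * (norm u + norm v + 1)" using h by simp
    also have "\<dots> = min d1 d2" using n by (simp add: h_def)
    finally show ?thesis .
  qed
  have diff: "f differentiable (at y)" "partial a f differentiable (at y)" for y a
    using f by (auto intro: smooth_differentiable smooth_partial)
  obtain s t where st: "0 < s" "s < h" "0 < t" "t < h"
    "f (z + h *\<^sub>R u + h *\<^sub>R v) - f (z + h *\<^sub>R u) - f (z + h *\<^sub>R v) + f z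
      = h * h * ?A (z + s *\<^sub>R u + t *\<^sub>R v)"
    using second_difference[where f=f and u=u and v=v and z=z, OF diff h] by auto
  obtain s' t' where st': "0 < s'" "s' < h" "0 < t'" "t' < h"
    "f (z + h *\<^sub>R v + h *\<^sub>R u) - f (z + h *\<^sub>R v) - f (z + h *\<^sub>R u) + f z
      = h * h * ?B (z + s' *\<^sub>R v + t' *\<^sub>R u)"
    using second_difference[where f=f and u=v and v=u and z=z, OF diff h] by auto
  have swap: "z + h *\<^sub>R v + h *\<^sub>R u = z + h *\<^sub>R u + h *\<^sub>R v" by (simp add: algebra_simps)
  have "h * h * ?A (z + s *\<^sub>R u + t *\<^sub>R v) = h * h * ?B (z + s' *\<^sub>R v + t' *\<^sub>R u)"
    using st(5) st'(5) unfolding swap by linarith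
  then have "?A (z + s *\<^sub>R u + t *\<^sub>R v) = ?B (z + s' *\<^sub>R v + t' *\<^sub>R u)"
    using h by simp
  moreover have "dist (?A (z + s *\<^sub>R u + t *\<^sub>R v)) (?A z) < e"
    using close[OF st(1-4)] by (intro d) auto
  moreover have "dist (?B (z + s' *\<^sub>R v + t' *\<^sub>R u)) (?B z) < e"
    using close[OF st'(1-4), of v u] by (intro d) auto
  ultimately show False unfolding dist_real_def e_def by (smt (verit) field_sum_of_halves)
qed

section \<open>Reduction of the Jacobi identity to coordinate functions\<close>

text \<open>If \<open>\<pi>\<close> is the matrix of brackets of coordinates, the inner bracket is
  again an entry of \<open>\<pi>\<close>, and bracketing with coordinate \<open>a\<close> is the
  vector field with components \<open>\<pi> a d\<close>. This gives the cyclic sum of double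
  brackets of three coordinates.\<close>

definition jacobiator ::
    "('i::finite \<Rightarrow> 'a::euclidean_space) \<Rightarrow> ('i \<Rightarrow> 'i \<Rightarrow> 'a \<Rightarrow> real) \<Rightarrow> 'i \<Rightarrow> 'i \<Rightarrow> 'i \<Rightarrow> 'a \<Rightarrow> real"
  where "jacobiator e \<pi> a b c z = (\<Sum>d\<in>UNIV. \<pi> a d z * partial (e d) (\<pi> b c) z
    + \<pi> b d z * partial (e d) (\<pi> c a) z + \<pi> c d z * partial (e d) (\<pi> a b) z)"

text \<open>The product rule differentiates \<open>\<pi>\<close>, the derivatives of
  \<open>g\<close> or those of \<open>h\<close>. The last two contributions have the same shape
  \<open>S\<close>, with opposite signs because \<open>\<pi> b c\<close> changes sign when the roles
  of \<open>g\<close> and \<open>h\<close> are exchanged.\<close>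

lemma biderivation_nested:
  fixes e :: "'i::finite \<Rightarrow> 'a::euclidean_space" and z :: 'a
  assumes skew: "\<And>a b z. \<pi> a b z = - \<pi> b a z"
    and diff: "\<And>a b z. \<pi> a b differentiable (at z)"
    and g: "smooth g" and h: "smooth h"
  defines "S \<equiv> \<lambda>F G H. (\<Sum>a\<in>UNIV. \<Sum>d\<in>UNIV. \<Sum>b\<in>UNIV. \<Sum>c\<in>UNIV.
      \<pi> a d z * \<pi> b c z * partial (e a) F z * partial (e d) (partial (e b) G) z * partial (e c) H z)"
  shows "biderivation e \<pi> f (biderivation e \<pi> g h) z =
    (\<Sum>a\<in>UNIV. \<Sum>d\<in>UNIV. \<Sum>b\<in>UNIV. \<Sum>c\<in>UNIV. \<pi> a d z * partial (e d) (\<pi> b c) z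
      * partial (e a) f z * partial (e b) g z * partial (e c) h z) + S f g h - S f h g"
proof -
  note D = has_derivative_partial[OF diff]
    has_derivative_partial[OF smooth_differentiable[OF smooth_partial[OF g]]]
    has_derivative_partial[OF smooth_differentiable[OF smooth_partial[OF h]]]
  have "partial v (biderivation e \<pi> g h) z = (\<Sum>b\<in>UNIV. \<Sum>c\<in>UNIV.
      partial v (\<pi> b c) z * partial (e b) g z * partial (e c) h z
      + \<pi> b c z * partial v (partial (e b) g) z * partial (e c) h z
      + \<pi> b c z * partial v (partial (e c) h) z * partial (e b) g z)" for v
    unfolding biderivation_def[abs_def]
    by (rule partial_eqI) (auto intro!: derivative_eq_intros D ext sum.cong simp: algebra_simps)
  then have "biderivation e \<pi> f (biderivation e \<pi> g h) z =
    (\<Sum>a\<in>UNIV. \<Sum>d\<in>UNIV. \<Sum>b\<in>UNIV. \<Sum>c\<in>UNIV. \<pi> a d z * partial (e d) (\<pi> b c) z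
      * partial (e a) f z * partial (e b) g z * partial (e c) h z) + S f g h
    + (\<Sum>a\<in>UNIV. \<Sum>d\<in>UNIV. \<Sum>b\<in>UNIV. \<Sum>c\<in>UNIV. \<pi> a d z * \<pi> b c z * partial (e a) f z
        * partial (e d) (partial (e c) h) z * partial (e b) g z)"
    unfolding biderivation_def[of _ _ f] S_def
    by (simp add: sum_distrib_left sum.distrib algebra_simps)
  also have "(\<Sum>a\<in>UNIV. \<Sum>d\<in>UNIV. \<Sum>b\<in>UNIV. \<Sum>c\<in>UNIV. \<pi> a d z * \<pi> b c z * partial (e a) f z
        * partial (e d) (partial (e c) h) z * partial (e b) g z)
      = (\<Sum>a\<in>UNIV. \<Sum>d\<in>UNIV. \<Sum>c\<in>UNIV. \<Sum>b\<in>UNIV. \<pi> a d z * - \<pi> c b z * partial (e a) f z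
        * partial (e d) (partial (e c) h) z * partial (e b) g z)"
    by (subst sum.swap, subst skew) simp
  also have "\<dots> = - S f h g"
    unfolding S_def by (simp add: sum_negf)
  finally show ?thesis by simp
qed

text \<open>The cyclic sum produces six terms \<open>S\<close>, two for each function that is
  differentiated twice. Each such pair cancels by \<open>S_sym\<close>, and the terms
  \<open>P\<close> with derivatives of \<open>\<pi>\<close> remain.\<close>

lemma biderivation_jacobiator:
  fixes e :: "'i::finite \<Rightarrow> 'a::euclidean_space" and z :: 'a
  assumes skew: "\<And>a b z. \<pi> a b z = - \<pi> b a z"
    and diff: "\<And>a b z. \<pi> a b differentiable (at z)"
    and f: "smooth f" and g: "smooth g" and h: "smooth h"
  defines "br \<equiv> biderivation e \<pi>"
  shows "br f (br g h) z + br g (br h f) z + br h (br f g) z =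
    (\<Sum>a\<in>UNIV. \<Sum>b\<in>UNIV. \<Sum>c\<in>UNIV.
      jacobiator e \<pi> a b c z * partial (e a) f z * partial (e b) g z * partial (e c) h z)"
proof -
  define S where "S = (\<lambda>F G H. (\<Sum>a\<in>UNIV. \<Sum>d\<in>UNIV. \<Sum>b\<in>UNIV. \<Sum>c\<in>UNIV.
      \<pi> a d z * \<pi> b c z * partial (e a) F z * partial (e d) (partial (e b) G) z * partial (e c) H z))"
  define P where "P = (\<lambda>F G H. (\<Sum>a\<in>UNIV. \<Sum>d\<in>UNIV. \<Sum>b\<in>UNIV. \<Sum>c\<in>UNIV. \<pi> a d z * partial (e d) (\<pi> b c) z
      * partial (e a) F z * partial (e b) G z * partial (e c) H z))"
  have nested: "br F (br G H) z = P F G H + S F G H - S F H G" if "smooth G" "smooth H" for F G H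
    unfolding br_def P_def S_def by (rule biderivation_nested[OF skew diff that])
  \<comment> \<open>Exchange \<open>a\<close> with \<open>c\<close> and \<open>d\<close> with
    \<open>b\<close>: both factors \<open>\<pi>\<close> change sign, and the second derivative of
    \<open>G\<close> has its two directions interchanged.\<close>
  have S_sym: "S H G F = S F G H" if G: "smooth G" for F G H
  proof -
    have "S H G F = (\<Sum>(a, d, b, c)\<in>UNIV. \<pi> a d z * \<pi> b c z * partial (e a) H z
        * partial (e d) (partial (e b) G) z * partial (e c) F z)"
      by (simp add: S_def sum.cartesian_product case_prod_beta)
    also have "\<dots> = (\<Sum>(a, d, b, c)\<in>UNIV. \<pi> a d z * \<pi> b c z * partial (e a) F z
        * partial (e d) (partial (e b) G) z * partial (e c) H z)"
    proof (rule sum.reindex_bij_witness[where i = "\<lambda>(a, d, b, c). (c, b, d, a)"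
          and j = "\<lambda>(a, d, b, c). (c, b, d, a)"], goal_cases)
      case (5 q)
      obtain a d b c where q: "q = (a, d, b, c)" by (cases q)
      show ?case
        using skew[of a d z] skew[of b c z] partial_commute[OF G, of "e d" "e b" z]
        by (simp add: q)
    qed auto
    also have "\<dots> = S F G H"
      by (simp add: S_def sum.cartesian_product case_prod_beta)
    finally show ?thesis .
  qed
  \<comment> \<open>With the contraction index \<open>d\<close> listed first, the cyclic
    permutations of the functions become relabellings of \<open>a\<close>, \<open>b\<close>,
    \<open>c\<close>.\<close>
  have P: "P F G H = (\<Sum>(d, a, b, c)\<in>UNIV. \<pi> a d z * partial (e d) (\<pi> b c) z
      * partial (e a) F z * partial (e b) G z * partial (e c) H z)" for F G H
    unfolding P_def by (subst sum.swap) (simp add: sum.cartesian_product case_prod_beta)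
  have P': "P G H F = (\<Sum>(d, a, b, c)\<in>UNIV. \<pi> b d z * partial (e d) (\<pi> c a) z
      * partial (e a) F z * partial (e b) G z * partial (e c) H z)" for F G H
    unfolding P
    by (rule sum.reindex_bij_witness[where i = "\<lambda>(d, a, b, c). (d, b, c, a)"
          and j = "\<lambda>(d, a, b, c). (d, c, a, b)"]) auto
  have P'': "P H F G = (\<Sum>(d, a, b, c)\<in>UNIV. \<pi> c d z * partial (e d) (\<pi> a b) z
      * partial (e a) F z * partial (e b) G z * partial (e c) H z)" for F G H
    unfolding P
    by (rule sum.reindex_bij_witness[where i = "\<lambda>(d, a, b, c). (d, c, a, b)"
          and j = "\<lambda>(d, a, b, c). (d, b, c, a)"]) auto
  have "br f (br g h) z + br g (br h f) z + br h (br f g) z = P f g h + P g h f + P h f g"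
    using S_sym[OF f, of g h] S_sym[OF g, of h f] S_sym[OF h, of f g] f g h
    by (simp add: nested)
  also have "\<dots> = (\<Sum>(d, a, b, c)\<in>UNIV. (\<pi> a d z * partial (e d) (\<pi> b c) z
      + \<pi> b d z * partial (e d) (\<pi> c a) z + \<pi> c d z * partial (e d) (\<pi> a b) z)
      * partial (e a) f z * partial (e b) g z * partial (e c) h z)"
    unfolding P[of f] P'[of g] P''[of h] sum.distrib[symmetric]
    by (rule sum.cong) (auto simp: algebra_simps)
  also have "\<dots> = (\<Sum>d\<in>UNIV. \<Sum>q\<in>UNIV. case q of (a, b, c) \<Rightarrow> (\<pi> a d z * partial (e d) (\<pi> b c) z
      + \<pi> b d z * partial (e d) (\<pi> c a) z + \<pi> c d z * partial (e d) (\<pi> a b) z)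
      * partial (e a) f z * partial (e b) g z * partial (e c) h z)"
    by (simp add: sum.cartesian_product case_prod_beta)
  also have "\<dots> = (\<Sum>(a, b, c)\<in>UNIV.
      jacobiator e \<pi> a b c z * partial (e a) f z * partial (e b) g z * partial (e c) h z)"
    by (subst sum.swap, rule sum.cong)
      (auto simp: jacobiator_def sum_distrib_right)
  finally show ?thesis
    by (simp add: sum.cartesian_product case_prod_beta)
qed

text \<open>The functions \<open>\<phi>\<close> are the linear coordinates dual to \<open>e\<close>.
  Testing on three of them isolates one coefficient in \<open>biderivation_jacobiator\<close>;
  conversely, vanishing coefficients annihilate that sum for all smooth functions.\<close>

lemma jacobi_identity_iff_jacobiator:
  fixes e :: "'i::finite \<Rightarrow> 'a::euclidean_space" and \<phi> :: "'i \<Rightarrow> 'a \<Rightarrow> real"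
  assumes skew: "\<And>a b z. \<pi> a b z = - \<pi> b a z"
    and diff: "\<And>a b z. \<pi> a b differentiable (at z)"
    and lin: "\<And>a. bounded_linear (\<phi> a)"
    and dual: "\<And>a b. \<phi> a (e b) = (if a = b then 1 else 0)"
  shows "jacobi_identity (biderivation e \<pi>) \<longleftrightarrow> (\<forall>a b c z. jacobiator e \<pi> a b c z = 0)"
proof
  assume J: "jacobi_identity (biderivation e \<pi>)"
  show "\<forall>a b c z. jacobiator e \<pi> a b c z = 0"
  proof (intro allI)
    fix a b c z
    note sm = smooth_bounded_linear[OF lin]
    have p: "partial (e i) (\<phi> j) z = (if i = j then 1 else 0)" for i j
      using partial_eqI[OF bounded_linear_imp_has_derivative[OF lin]] dual by simp
    have "(\<Sum>a'\<in>UNIV. \<Sum>b'\<in>UNIV. \<Sum>c'\<in>UNIV. jacobiator e \<pi> a' b' c' z * partial (e a') (\<phi> a) z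
        * partial (e b') (\<phi> b) z * partial (e c') (\<phi> c) z) = 0"
      using J sm unfolding jacobi_identity_def
      by (subst biderivation_jacobiator[OF skew diff, symmetric]) auto
    then show "jacobiator e \<pi> a b c z = 0"
      by (simp add: p if_distrib[of "\<lambda>t. _ * t"] if_distrib[of "\<lambda>t. t * _"] sum.delta cong: if_cong)
  qed
next
  assume "\<forall>a b c z. jacobiator e \<pi> a b c z = 0"
  then show "jacobi_identity (biderivation e \<pi>)"
    unfolding jacobi_identity_def by (simp add: biderivation_jacobiator[OF skew diff])
qed

section \<open>Commutators of placed tensors\<close>

lemma place12_nth: "place12 \<rho> $ (j, a, b) $ (l, m, n) = (if b = n then \<rho> $ (j, a) $ (l, m) else 0)"
proof -
  have "place12 \<rho> $ (j, a, b) $ (l, m, n) = (\<Sum>q\<in>UNIV. if q = ((j, a), (l, m))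
      then if b = n then \<rho> $ (j, a) $ (l, m) else 0 else 0)"
    unfolding place12_def sum_component
    by (rule sum.cong) (auto simp: tensor_def unit_mat_def mat_def split: if_splits)
  then show ?thesis by simp
qed

lemma place13_nth: "place13 \<rho> $ (j, a, b) $ (l, m, n) = (if a = m then \<rho> $ (j, b) $ (l, n) else 0)"
proof -
  have "place13 \<rho> $ (j, a, b) $ (l, m, n) = (\<Sum>q\<in>UNIV. if q = ((j, b), (l, n))
      then if a = m then \<rho> $ (j, b) $ (l, n) else 0 else 0)"
    unfolding place13_def sum_component
    by (rule sum.cong) (auto simp: tensor_def unit_mat_def mat_def split: if_splits)
  then show ?thesis by simp
qed

lemma place23_nth: "place23 \<rho> $ (j, a, b) $ (l, m, n) = (if j = l then \<rho> $ (a, b) $ (m, n) else 0)"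
proof -
  have "place23 \<rho> $ (j, a, b) $ (l, m, n) = (\<Sum>q\<in>UNIV. if q = ((a, b), (m, n))
      then if j = l then \<rho> $ (a, b) $ (m, n) else 0 else 0)"
    unfolding place23_def sum_component
    by (rule sum.cong) (auto simp: tensor_def unit_mat_def mat_def split: if_splits)
  then show ?thesis by simp
qed

lemma matrix_mult_nth3:
  fixes A B :: "'n::finite endo3"
  shows "(A ** B) $ p $ q = (\<Sum>x\<in>UNIV. \<Sum>y\<in>UNIV. \<Sum>z\<in>UNIV. A $ p $ (x, y, z) * B $ (x, y, z) $ q)"
proof -
  have "(A ** B) $ p $ q = (\<Sum>(x, y, z)\<in>UNIV. A $ p $ (x, y, z) * B $ (x, y, z) $ q)"
    by (simp add: matrix_matrix_mult_def case_prod_beta)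
  then show ?thesis by (simp add: sum.cartesian_product case_prod_beta)
qed

lemma sum_if_const: "(\<Sum>x\<in>A. if P then f x else 0) = (if P then sum f A else 0)"
  by simp

text \<open>Each identity factor contributes a Kronecker delta, so of the three intermediate indices
  only the one in the shared factor is still summed. These contractions are the ones that occur in
  the mixed Jacobiators.\<close>

lemma place_mult_nth:
  fixes u v :: "'n::finite endo2"
  shows
    "(place12 u ** place13 v) $ (j, a, b) $ (l, m, n) = (\<Sum>d\<in>UNIV. u $ (j, a) $ (d, m) * v $ (d, b) $ (l, n))"
    "(place13 u ** place12 v) $ (j, a, b) $ (l, m, n) = (\<Sum>d\<in>UNIV. u $ (j, b) $ (d, n) * v $ (d, a) $ (l, m))"
    "(place12 u ** place23 v) $ (j, a, b) $ (l, m, n) = (\<Sum>d\<in>UNIV. u $ (j, a) $ (l, d) * v $ (d, b) $ (m, n))"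
    "(place23 u ** place12 v) $ (j, a, b) $ (l, m, n) = (\<Sum>d\<in>UNIV. u $ (a, b) $ (d, n) * v $ (j, d) $ (l, m))"
    "(place13 u ** place23 v) $ (j, a, b) $ (l, m, n) = (\<Sum>d\<in>UNIV. u $ (j, b) $ (l, d) * v $ (a, d) $ (m, n))"
    "(place23 u ** place13 v) $ (j, a, b) $ (l, m, n) = (\<Sum>d\<in>UNIV. u $ (a, b) $ (m, d) * v $ (j, d) $ (l, n))"
  by (simp_all add: matrix_mult_nth3 place12_nth place13_nth place23_nth
      if_distrib[of "\<lambda>t. t * _"] if_distrib[of "\<lambda>t. _ * t"] sum_if_const cong: if_cong)

lemma linear_place: "linear place12" "linear place13" "linear place23"
  by (auto intro!: linearI simp: vec_eq_iff place12_nth place13_nth place23_nth)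

lemma place23_eq_tensor: "place23 \<rho> = \<one> \<otimes> \<rho>"
  by (auto simp: vec_eq_iff place23_nth tensor_def mat_def)

lemma place12_mult: "place12 (\<rho> ** \<sigma>) = place12 \<rho> ** place12 \<sigma>"
proof -
  have "(\<rho> ** \<sigma>) $ p $ q = (\<Sum>x\<in>UNIV. \<Sum>y\<in>UNIV. \<rho> $ p $ (x, y) * \<sigma> $ (x, y) $ q)" for p q
    by (simp add: matrix_matrix_mult_def sum.cartesian_product case_prod_beta)
  then show ?thesis
    by (simp add: vec_eq_iff matrix_mult_nth3 place12_nth
      if_distrib[of "\<lambda>t. t * _"] if_distrib[of "\<lambda>t. _ * t"] sum_if_const cong: if_cong)
qed

lemma place12_third_factor_commute: "place12 \<rho> ** (\<one> \<otimes> \<one> \<otimes> B) = (\<one> \<otimes> \<one> \<otimes> B) ** place12 \<rho>"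
  by (simp add: vec_eq_iff matrix_mult_nth3 place12_nth tensor_def mat_def mult.commute
      if_distrib[of "\<lambda>t. t * _"] if_distrib[of "\<lambda>t. _ * t"] sum_if_const cong: if_cong)

lemma bilinear_matrix_mult: "bilinear ((**) :: real ^ 'a::finite ^ 'a \<Rightarrow> _)"
  unfolding bilinear_def
  by (auto intro!: linearI simp: matrix_matrix_mult_def vec_eq_iff algebra_simps sum.distrib
        sum_distrib_left)

lemmas matrix_mult_distribs =
  bilinear_ladd[OF bilinear_matrix_mult] bilinear_radd[OF bilinear_matrix_mult]
  bilinear_lsub[OF bilinear_matrix_mult] bilinear_rsub[OF bilinear_matrix_mult]
  bilinear_lmul[OF bilinear_matrix_mult] bilinear_rmul[OF bilinear_matrix_mult]

section \<open>Vanishing commutators from the invariance of \<open>s\<close>\<close>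

lemma tensor_square_induct [consumes 1, case_names tensor linear]:
  assumes "w \<in> tensor_square \<gg>"
    and "\<And>A B. A \<in> \<gg> \<Longrightarrow> B \<in> \<gg> \<Longrightarrow> F (A \<otimes> B) = 0" and "linear F"
  shows "F w = 0"
  by (rule linear_eq_0_on_span[OF assms(3) _ assms(1)[unfolded tensor_square_def]])
    (use assms(2) in auto)

lemma linear_commutator_left: "linear F \<Longrightarrow> linear (\<lambda>w. commutator (F w) C)"
  by (rule linear_compose[unfolded o_def, where g = "\<lambda>A. commutator A C"])
    (use bilinear_commutator in \<open>auto simp: bilinear_def\<close>)

lemma commutator_swap: "commutator A B = - commutator B A"
  by (simp add: commutator_def)

text \<open>For \<open>w = A \<otimes> B\<close> the sum of the placed tensors is
  \<open>A \<otimes> (B \<otimes> \<one> + \<one> \<otimes> B)\<close>, so the commutator is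
  \<open>A\<close> tensored with the action of \<open>B\<close> on \<open>s\<close>. Linearity
  extends this to all of \<open>tensor_square\<close>.\<close>

lemma invariant_commutator_23:
  assumes s: "invariant2 \<gg> s" and w: "w \<in> tensor_square \<gg>"
  shows "commutator (place12 w + place13 w) (place23 s) = 0"
  using w
proof (induction rule: tensor_square_induct)
  case (tensor A B)
  have "commutator (place12 (A \<otimes> B) + place13 (A \<otimes> B)) (place23 s)
      = commutator (A \<otimes> (B \<otimes> \<one> + \<one> \<otimes> B)) (\<one> \<otimes> s)"
    by (simp add: place12_tensor place13_tensor place23_eq_tensor tensor_distribs add.commute)
  also have "\<dots> = A \<otimes> commutator (B \<otimes> \<one> + \<one> \<otimes> B) s"
    by (simp add: commutator_def tensor_mult tensor_distribs matrix_mult_distribs)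
  also have "\<dots> = 0"
    using s tensor by (simp add: invariant2_def bilinear_rzero[OF bilinear_tensor])
  finally show ?case .
next
  case linear
  show ?case
    by (intro linear_commutator_left linear_compose_add linear_place)
qed

text \<open>The mirror image of \<open>invariant_commutator_23\<close>: now \<open>A\<close> acts on
  \<open>s\<close> and \<open>B\<close> sits in the third factor. Triple tensors nest to the right,
  so the first two factors cannot be split off directly; instead the tensor is written as
  \<open>place12 X\<close> times \<open>?C\<close>, and \<open>?C\<close> commutes with everything
  in the first two factors.\<close>

lemma invariant_commutator_12:
  assumes s: "invariant2 \<gg> s" and w: "w \<in> tensor_square \<gg>"
  shows "commutator (place13 w + place23 w) (place12 s) = 0"
  using w
proof (induction rule: tensor_square_induct)
  case (tensor A B)
  define X where "X = A \<otimes> \<one> + \<one> \<otimes> A"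
  let ?C = "\<one> \<otimes> \<one> \<otimes> B"
  have "place13 (A \<otimes> B) + place23 (A \<otimes> B) = place12 X ** ?C"
    by (simp add: X_def linear_add[OF linear_place(1)] place12_tensor place13_tensor place23_tensor
        matrix_mult_distribs tensor_mult)
  moreover have "place12 X ** ?C ** place12 s = place12 X ** place12 s ** ?C"
    by (metis matrix_mul_assoc place12_third_factor_commute)
  ultimately have "commutator (place13 (A \<otimes> B) + place23 (A \<otimes> B)) (place12 s)
      = place12 (commutator X s) ** ?C"
    by (simp only: commutator_def linear_diff[OF linear_place(1)] place12_mult
        matrix_mult_distribs matrix_mul_assoc)
  also have "\<dots> = 0"
    using s tensor by (simp add: X_def invariant2_def linear_0[OF linear_place(1)])
  finally show ?case .
next
  case linear
  show ?case
    by (intro linear_commutator_left linear_compose_add linear_place)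
qed

section \<open>Skew tensors, multiples of the identity and the Yang-Baxter equation\<close>

lemma exterior_square_subset: "exterior_square \<gg> \<subseteq> tensor_square \<gg>"
proof -
  have "wedge2 A B \<in> tensor_square \<gg>" if "A \<in> \<gg>" "B \<in> \<gg>" for A B
    unfolding wedge2_def tensor_square_def using that by (intro span_diff span_base) blast+
  then show ?thesis
    unfolding exterior_square_def by (intro span_minimal) (auto simp: tensor_square_def)
qed

lemma exterior_square_skew:
  fixes r :: "'n::finite endo2"
  assumes "r \<in> exterior_square \<gg>"
  shows "r $ (j, k) $ (l, m) = - r $ (k, j) $ (m, l)"
proof -
  have "linear (\<lambda>r::'n endo2. r $ (j, k) $ (l, m) + r $ (k, j) $ (m, l))"
    by (auto intro!: linearI simp: algebra_simps)
  then have "r $ (j, k) $ (l, m) + r $ (k, j) $ (m, l) = 0"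
    by (rule linear_eq_0_on_span[OF _ _ assms[unfolded exterior_square_def]])
      (auto simp: wedge2_def tensor_def)
  then show ?thesis by simp
qed

lemma tensor_one: "\<one> \<otimes> \<one> = \<one>"
  by (auto simp: vec_eq_iff tensor_def mat_def)

lemma place_scaled_identity:
  "place12 (c *\<^sub>R (\<one> \<otimes> \<one>)) = (c *\<^sub>R \<one> :: 'n::finite endo3)"
  "place13 (c *\<^sub>R (\<one> \<otimes> \<one>)) = (c *\<^sub>R \<one> :: 'n::finite endo3)"
  "place23 (c *\<^sub>R (\<one> \<otimes> \<one>)) = (c *\<^sub>R \<one> :: 'n::finite endo3)"
  using place12_tensor[of "\<one> :: 'n endo" \<one>] place13_tensor[of "\<one> :: 'n endo" \<one>]
    place23_tensor[of "\<one> :: 'n endo" \<one>]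
  by (simp_all add: linear_scale[OF linear_place(1)] linear_scale[OF linear_place(2)]
      linear_scale[OF linear_place(3)] tensor_one)

lemma commutator_scaled_identity: "commutator (c *\<^sub>R \<one>) A = 0" "commutator A (c *\<^sub>R \<one>) = 0"
  by (simp_all add: commutator_def matrix_mult_distribs)

text \<open>Replacing \<open>w\<close> by \<open>r\<close> in one of its three places costs a commutator with \<open>s\<close>, which
  vanishes by invariance; the multiple of the identity is central.\<close>

lemma Yang_Baxter_variants:
  fixes r s :: "'n::finite endo2" and c :: real
  assumes r: "r \<in> exterior_square \<gg>" and s: "s \<in> tensor_square \<gg>" "invariant2 \<gg> s"
    and CYBE: "classical_Yang_Baxter (r + s)"
  defines "w \<equiv> r + s + c *\<^sub>R (\<one> \<otimes> \<one>)"
  shows "commutator (place12 w) (place13 w) + commutator (place12 w) (place23 r)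
      + commutator (place13 w) (place23 r) = 0"
    and "commutator (place12 r) (place13 w) + commutator (place12 r) (place23 w)
      + commutator (place13 w) (place23 w) = 0"
proof -
  let ?W = "r + s"
  have W: "?W \<in> tensor_square \<gg>"
    using r s(1) exterior_square_subset unfolding tensor_square_def by (auto intro: span_add)
  note add = linear_add[OF linear_place(1)] linear_add[OF linear_place(2)]
    linear_add[OF linear_place(3)]
  note ladd = bilinear_ladd[OF bilinear_commutator]
  note radd = bilinear_radd[OF bilinear_commutator]
  have w: "commutator (place12 w) X = commutator (place12 ?W) X"
    "commutator (place13 w) X = commutator (place13 ?W) X"
    "commutator X (place13 w) = commutator X (place13 ?W)"
    "commutator X (place23 w) = commutator X (place23 ?W)" for X
    by (simp_all only: w_def add[of ?W] place_scaled_identity ladd radd commutator_scaled_identity add_0_right)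
  note YB = CYBE[unfolded classical_Yang_Baxter_def]
  \<comment> \<open>Here \<open>b'\<close> and \<open>d'\<close> stand for the two commutators with
    \<open>s\<close>. Invariance controls only their sum, so they are removed together.\<close>
  have cancel: "a + b + d = 0" if "a + (b + b') + (d + d') = 0" "b' + d' = 0" for a b b' d d' :: "'n endo3"
  proof -
    have "a + b + d = a + (b + b') + (d + d') - (b' + d')" by simp
    then show ?thesis using that by simp
  qed
  have "commutator (place12 ?W) (place23 s) + commutator (place13 ?W) (place23 s) = 0"
    using invariant_commutator_23[OF s(2) W] by (simp only: ladd)
  from cancel[OF YB[unfolded add(3)[of r s] radd] this]
  show "commutator (place12 w) (place13 w) + commutator (place12 w) (place23 r)
      + commutator (place13 w) (place23 r) = 0"
    unfolding w .
  have 2: "commutator (place12 s) (place13 ?W) + commutator (place12 s) (place23 ?W) = 0"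
    using invariant_commutator_12[OF s(2) W]
      commutator_swap[of "place12 s" "place13 ?W + place23 ?W"]
    by (simp only: radd minus_zero)
  have "commutator (place13 ?W) (place23 ?W)
      + (commutator (place12 r) (place13 ?W) + commutator (place12 s) (place13 ?W))
      + (commutator (place12 r) (place23 ?W) + commutator (place12 s) (place23 ?W)) = 0"
    using YB unfolding add(1)[of r s] ladd by (simp only: ac_simps)
  from cancel[OF this 2]
  show "commutator (place12 r) (place13 w) + commutator (place12 r) (place23 w)
      + commutator (place13 w) (place23 w) = 0"
    unfolding w by (simp only: ac_simps)
qed

section \<open>Brackets of the cotangent coordinates\<close>

lemma sum_swap4:
  "(\<Sum>d\<in>UNIV. \<Sum>j\<in>UNIV. \<Sum>m\<in>UNIV. \<Sum>n\<in>UNIV. f d j m n)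
    = (\<Sum>j\<in>UNIV. \<Sum>m\<in>UNIV. \<Sum>n\<in>UNIV. \<Sum>d\<in>UNIV. f d j m n)"
proof -
  have "(\<Sum>d\<in>UNIV. \<Sum>j\<in>UNIV. \<Sum>m\<in>UNIV. \<Sum>n\<in>UNIV. f d j m n)
      = (\<Sum>j\<in>UNIV. \<Sum>m\<in>UNIV. \<Sum>d\<in>UNIV. \<Sum>n\<in>UNIV. f d j m n)"
    by (subst sum.swap) (intro sum.cong refl sum.swap)
  also have "\<dots> = (\<Sum>j\<in>UNIV. \<Sum>m\<in>UNIV. \<Sum>n\<in>UNIV. \<Sum>d\<in>UNIV. f d j m n)"
    by (intro sum.cong refl sum.swap)
  finally show ?thesis .
qed

text \<open>The left side is the Jacobiator of \<open>p l\<close>, \<open>x a\<close>,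
  \<open>x b\<close> written out, with \<open>X\<close> the position brackets and \<open>W\<close>
  the mixed ones. The Kronecker deltas in \<open>W\<close> give the linear terms on the right; all
  cubic terms form the contraction of \<open>YB\<close>. Plain index functions replace tensors so
  that the identity also applies to transposed data.\<close>

lemma mixed_jacobiator_sum:
  fixes r w :: "'n::finite \<Rightarrow> 'n \<Rightarrow> 'n \<Rightarrow> 'n \<Rightarrow> real" and x p :: "'n \<Rightarrow> real" and l a b :: 'n
  assumes skew: "\<And>a b l m. r a b l m = - r b a m l"
    and YB: "\<And>j m n. (\<Sum>d\<in>UNIV. w j a d m * w d b l n) - (\<Sum>d\<in>UNIV. w j b d n * w d a l m)
      + ((\<Sum>d\<in>UNIV. w j a l d * r d b m n) - (\<Sum>d\<in>UNIV. r a b d n * w j d l m))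
      + ((\<Sum>d\<in>UNIV. w j b l d * r a d m n) - (\<Sum>d\<in>UNIV. r a b m d * w j d l n)) = 0"
  defines "X \<equiv> \<lambda>a b. \<Sum>l\<in>UNIV. \<Sum>m\<in>UNIV. r a b l m * x l * x m"
    and "W \<equiv> \<lambda>l k. (if l = k then 1 else 0) - (\<Sum>j\<in>UNIV. \<Sum>m\<in>UNIV. p j * w j k l m * x m)"
  shows "(\<Sum>d\<in>UNIV. W l d * (\<Sum>m\<in>UNIV. (r a b d m + r a b m d) * x m))
      + (\<Sum>d\<in>UNIV. X a d * (\<Sum>j\<in>UNIV. p j * w j b l d))
      - (\<Sum>d\<in>UNIV. W d a * (\<Sum>m\<in>UNIV. w d b l m * x m))
      - (\<Sum>d\<in>UNIV. X b d * (\<Sum>j\<in>UNIV. p j * w j a l d))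
      + (\<Sum>d\<in>UNIV. W d b * (\<Sum>m\<in>UNIV. w d a l m * x m))
    = (\<Sum>m\<in>UNIV. (r a b l m - r b a l m + w b a l m - w a b l m) * x m)"
proof -
  \<comment> \<open>Contraction with \<open>p\<close> in the first slot and \<open>x\<close> in the
    other two. It is unchanged when \<open>m\<close> and \<open>n\<close> are exchanged, which
    \<open>C_swap\<close> uses to match terms with \<open>YB\<close>.\<close>
  define C where "C F = (\<Sum>j\<in>UNIV. \<Sum>m\<in>UNIV. \<Sum>n\<in>UNIV. p j * x m * x n * F j m n)" for F
  have C_swap: "C (\<lambda>j m n. F j n m) = C F" for F
    unfolding C_def by (rule sum.cong[OF refl], subst sum.swap, intro sum.cong refl) (simp add: mult_ac)
  have C_add: "C F + C G = C (\<lambda>j m n. F j m n + G j m n)" for F G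
    by (simp add: C_def sum.distrib algebra_simps)
  have C_diff: "C F - C G = C (\<lambda>j m n. F j m n - G j m n)" for F G
    by (simp add: C_def sum_subtractf algebra_simps)
  have px: "(\<Sum>d\<in>UNIV. (\<Sum>j\<in>UNIV. \<Sum>m\<in>UNIV. p j * A j d m * x m) * (\<Sum>n\<in>UNIV. B d n * x n))
      = C (\<lambda>j m n. \<Sum>d\<in>UNIV. A j d m * B d n)" for A B
  proof -
    have "(\<Sum>d\<in>UNIV. (\<Sum>j\<in>UNIV. \<Sum>m\<in>UNIV. p j * A j d m * x m) * (\<Sum>n\<in>UNIV. B d n * x n))
      = (\<Sum>d\<in>UNIV. \<Sum>j\<in>UNIV. \<Sum>m\<in>UNIV. \<Sum>n\<in>UNIV. p j * x m * x n * (A j d m * B d n))"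
      by (simp add: sum_distrib_left sum_distrib_right mult_ac)
    then show ?thesis
      by (subst (asm) sum_swap4) (simp add: C_def sum_distrib_left)
  qed
  have xx: "(\<Sum>d\<in>UNIV. (\<Sum>m\<in>UNIV. \<Sum>n\<in>UNIV. A d m n * x m * x n) * (\<Sum>j\<in>UNIV. p j * B j d))
      = C (\<lambda>j m n. \<Sum>d\<in>UNIV. A d m n * B j d)" for A B
  proof -
    have "(\<Sum>d\<in>UNIV. (\<Sum>m\<in>UNIV. \<Sum>n\<in>UNIV. A d m n * x m * x n) * (\<Sum>j\<in>UNIV. p j * B j d))
      = (\<Sum>d\<in>UNIV. \<Sum>j\<in>UNIV. \<Sum>m\<in>UNIV. \<Sum>n\<in>UNIV. p j * x m * x n * (A d m n * B j d))"
      by (simp only: sum_distrib_left, simp only: sum_distrib_right, simp add: mult_ac)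
    then show ?thesis
      by (subst (asm) sum_swap4) (simp add: C_def sum_distrib_left)
  qed
  \<comment> \<open>Separates the linear part of each product with \<open>W\<close> from its cubic
    part.\<close>
  have delta: "(\<Sum>d\<in>UNIV. ((if c = d then 1 else 0) - U d) * v d) = v c - (\<Sum>d\<in>UNIV. U d * v d)"
    "(\<Sum>d\<in>UNIV. ((if d = c then 1 else 0) - U d) * v d) = v c - (\<Sum>d\<in>UNIV. U d * v d)"
    for c :: 'n and U v :: "'n \<Rightarrow> real"
    by (simp_all add: left_diff_distrib sum_subtractf if_distrib[of "\<lambda>t. t * _"] cong: if_cong)
  have 1: "(\<Sum>d\<in>UNIV. W l d * (\<Sum>m\<in>UNIV. (r a b d m + r a b m d) * x m))
      = (\<Sum>m\<in>UNIV. (r a b l m + r a b m l) * x m)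
        - C (\<lambda>j m n. (\<Sum>d\<in>UNIV. r a b d n * w j d l m) + (\<Sum>d\<in>UNIV. r a b m d * w j d l n))"
  proof -
    have "C (\<lambda>j m n. \<Sum>d\<in>UNIV. w j d l m * (r a b d n + r a b n d))
        = C (\<lambda>j m n. \<Sum>d\<in>UNIV. r a b d n * w j d l m) + C (\<lambda>j m n. \<Sum>d\<in>UNIV. r a b n d * w j d l m)"
      unfolding C_add by (simp add: sum.distrib algebra_simps)
    also have "C (\<lambda>j m n. \<Sum>d\<in>UNIV. r a b n d * w j d l m) = C (\<lambda>j m n. \<Sum>d\<in>UNIV. r a b m d * w j d l n)"
      by (rule C_swap)
    finally show ?thesis unfolding W_def delta px C_add by simp
  qed
  have 2: "(\<Sum>d\<in>UNIV. X a d * (\<Sum>j\<in>UNIV. p j * w j b l d)) = C (\<lambda>j m n. \<Sum>d\<in>UNIV. w j b l d * r a d m n)"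
    unfolding X_def xx by (simp add: mult.commute)
  have 3: "(\<Sum>d\<in>UNIV. W d a * (\<Sum>m\<in>UNIV. w d b l m * x m))
      = (\<Sum>m\<in>UNIV. w a b l m * x m) - C (\<lambda>j m n. \<Sum>d\<in>UNIV. w j a d m * w d b l n)"
    unfolding W_def delta px ..
  have 4: "(\<Sum>d\<in>UNIV. X b d * (\<Sum>j\<in>UNIV. p j * w j a l d)) = - C (\<lambda>j m n. \<Sum>d\<in>UNIV. w j a l d * r d b m n)"
  proof -
    have "(\<Sum>d\<in>UNIV. X b d * (\<Sum>j\<in>UNIV. p j * w j a l d)) = C (\<lambda>j m n. \<Sum>d\<in>UNIV. r b d n m * w j a l d)"
      unfolding X_def xx by (rule C_swap[symmetric])
    also have "\<dots> = - C (\<lambda>j m n. \<Sum>d\<in>UNIV. w j a l d * r d b m n)"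
      unfolding C_def by (subst skew) (simp add: sum_negf mult_ac)
    finally show ?thesis .
  qed
  have 5: "(\<Sum>d\<in>UNIV. W d b * (\<Sum>m\<in>UNIV. w d a l m * x m))
      = (\<Sum>m\<in>UNIV. w b a l m * x m) - C (\<lambda>j m n. \<Sum>d\<in>UNIV. w j b d n * w d a l m)"
    unfolding W_def delta px by (simp add: C_swap[of "\<lambda>j m n. \<Sum>d\<in>UNIV. w j b d n * w d a l m"])
  have "C (\<lambda>j m n. (\<Sum>d\<in>UNIV. w j a d m * w d b l n) - (\<Sum>d\<in>UNIV. w j b d n * w d a l m)
      + ((\<Sum>d\<in>UNIV. w j a l d * r d b m n) - (\<Sum>d\<in>UNIV. r a b d n * w j d l m))
      + ((\<Sum>d\<in>UNIV. w j b l d * r a d m n) - (\<Sum>d\<in>UNIV. r a b m d * w j d l n))) = 0"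
    unfolding YB by (simp add: C_def)
  then have cubic: "C (\<lambda>j m n. \<Sum>d\<in>UNIV. w j a d m * w d b l n) - C (\<lambda>j m n. \<Sum>d\<in>UNIV. w j b d n * w d a l m)
      + (C (\<lambda>j m n. \<Sum>d\<in>UNIV. w j a l d * r d b m n) - C (\<lambda>j m n. \<Sum>d\<in>UNIV. r a b d n * w j d l m))
      + (C (\<lambda>j m n. \<Sum>d\<in>UNIV. w j b l d * r a d m n) - C (\<lambda>j m n. \<Sum>d\<in>UNIV. r a b m d * w j d l n)) = 0"
    unfolding C_diff C_add .
  have "(\<Sum>m\<in>UNIV. (r a b l m - r b a l m + w b a l m - w a b l m) * x m)
      = (\<Sum>m\<in>UNIV. (r a b l m + r a b m l) * x m) + (\<Sum>m\<in>UNIV. w b a l m * x m)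
        - (\<Sum>m\<in>UNIV. w a b l m * x m)"
    unfolding sum.distrib[symmetric] sum_subtractf[symmetric]
    by (intro sum.cong refl) (subst skew[of b a], simp add: algebra_simps)
  then show ?thesis
    using cubic unfolding 1 2 3 4 5 C_add[symmetric] by linarith
qed

section \<open>Derivatives of the coordinate brackets\<close>

text \<open>Up to sign and an additive constant every coordinate bracket is such a form; two
  families \<open>f\<close> and \<open>g\<close> are allowed because mixed brackets pair momenta
  with positions.\<close>

lemma has_derivative_quadratic:
  assumes f: "\<And>l. bounded_linear (f l)" and g: "\<And>m. bounded_linear (g m)"
  shows "((\<lambda>z. \<Sum>l\<in>UNIV. \<Sum>m\<in>UNIV. c l m * f l z * g m z) has_derivative
    (\<lambda>v. \<Sum>l\<in>UNIV. \<Sum>m\<in>UNIV. c l m * f l v * g m z + c l m * f l z * g m v :: real)) (at z)"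
proof -
  have "((\<lambda>z. c l m * f l z * g m z) has_derivative
      (\<lambda>v. c l m * f l z * g m v + c l m * f l v * g m z)) (at z)" for l m
    by (intro has_derivative_mult has_derivative_mult_right bounded_linear_imp_has_derivative f g)
  then show ?thesis
    by (intro has_derivative_sum) (simp add: add.commute)
qed

lemma bounded_linear_coordinate:
  "bounded_linear (\<lambda>z::(real ^ 'n::finite) \<times> (real ^ 'n). fst z $ l)"
  "bounded_linear (\<lambda>z::(real ^ 'n::finite) \<times> (real ^ 'n). snd z $ l)"
  by (rule bounded_linear_compose[OF bounded_linear_vec_nth bounded_linear_fst]
      bounded_linear_compose[OF bounded_linear_vec_nth bounded_linear_snd])+

lemma coord_bracket_cotangent_eq:
  "coord_bracket_cotangent r w (Inl a) (Inl b)
    = (\<lambda>z. \<Sum>l\<in>UNIV. \<Sum>m\<in>UNIV. r $ (a, b) $ (l, m) * fst z $ l * fst z $ m)"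
  "coord_bracket_cotangent r w (Inr l) (Inr m)
    = (\<lambda>z. \<Sum>j\<in>UNIV. \<Sum>k\<in>UNIV. r $ (j, k) $ (l, m) * snd z $ j * snd z $ k)"
  "coord_bracket_cotangent r w (Inr l) (Inl k) = (\<lambda>z. (if l = k then 1 else 0)
    - (\<Sum>j\<in>UNIV. \<Sum>m\<in>UNIV. w $ (j, k) $ (l, m) * snd z $ j * fst z $ m))"
  "coord_bracket_cotangent r w (Inl k) (Inr l) = (\<lambda>z. - ((if l = k then 1 else 0)
    - (\<Sum>j\<in>UNIV. \<Sum>m\<in>UNIV. w $ (j, k) $ (l, m) * snd z $ j * fst z $ m)))"
  by (auto simp: fun_eq_iff coord_bracket_V_def coord_bracket_dual_def coord_bracket_px_def mult_ac)

text \<open>The \<open>0 -\<close> is the derivative of the constant Kronecker term, left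
  unsimplified so that the derivative rules match as they stand.\<close>

lemma coord_bracket_has_derivative:
  fixes r w :: "'n::finite endo2"
  shows "(coord_bracket_cotangent r w (Inl a) (Inl b) has_derivative
      (\<lambda>v. \<Sum>l\<in>UNIV. \<Sum>m\<in>UNIV. r $ (a, b) $ (l, m) * fst v $ l * fst z $ m
        + r $ (a, b) $ (l, m) * fst z $ l * fst v $ m)) (at z)"
    and "(coord_bracket_cotangent r w (Inr l) (Inr m) has_derivative
      (\<lambda>v. \<Sum>j\<in>UNIV. \<Sum>k\<in>UNIV. r $ (j, k) $ (l, m) * snd v $ j * snd z $ k
        + r $ (j, k) $ (l, m) * snd z $ j * snd v $ k)) (at z)"
    and "(coord_bracket_cotangent r w (Inr l) (Inl k) has_derivative
      (\<lambda>v. 0 - (\<Sum>j\<in>UNIV. \<Sum>m\<in>UNIV. w $ (j, k) $ (l, m) * snd v $ j * fst z $ m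
        + w $ (j, k) $ (l, m) * snd z $ j * fst v $ m))) (at z)"
    and "(coord_bracket_cotangent r w (Inl k) (Inr l) has_derivative
      (\<lambda>v. - (0 - (\<Sum>j\<in>UNIV. \<Sum>m\<in>UNIV. w $ (j, k) $ (l, m) * snd v $ j * fst z $ m
        + w $ (j, k) $ (l, m) * snd z $ j * fst v $ m)))) (at z)"
  unfolding coord_bracket_cotangent_eq
  by (intro has_derivative_minus has_derivative_diff has_derivative_const has_derivative_quadratic
      bounded_linear_coordinate)+

lemma coord_bracket_differentiable:
  "coord_bracket_cotangent r w a b differentiable (at z)"
  unfolding differentiable_def
  by (cases a; cases b; hypsubst; rule exI; rule coord_bracket_has_derivative)

lemma sum_axis:
  fixes f :: "'n::finite \<Rightarrow> real"
  shows "(\<Sum>l\<in>UNIV. f l * (axis d 1 :: real ^ 'n) $ l) = f d"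
  by (simp add: axis_def if_distrib[of "\<lambda>t. _ * t"] cong: if_cong)

lemma sum_axis_outer:
  fixes f :: "'n::finite \<Rightarrow> 'n \<Rightarrow> real"
  shows "(\<Sum>l\<in>UNIV. \<Sum>m\<in>UNIV. f l m * (axis d 1 :: real ^ 'n) $ l * g m) = (\<Sum>m\<in>UNIV. f d m * g m)"
  by (subst sum.swap) (simp add: sum_axis sum_distrib_right[symmetric])

lemma partial_coord_bracket:
  fixes r w :: "'n::finite endo2"
  shows "partial (cotangent_basis (Inl d)) (coord_bracket_cotangent r w (Inl a) (Inl b)) z
      = (\<Sum>m\<in>UNIV. (r $ (a, b) $ (d, m) + r $ (a, b) $ (m, d)) * fst z $ m)"
    and "partial (cotangent_basis (Inr d)) (coord_bracket_cotangent r w (Inl a) (Inl b)) z = 0"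
    and "partial (cotangent_basis (Inl d)) (coord_bracket_cotangent r w (Inr l) (Inr m)) z = 0"
    and "partial (cotangent_basis (Inr d)) (coord_bracket_cotangent r w (Inr l) (Inr m)) z
      = (\<Sum>k\<in>UNIV. (r $ (d, k) $ (l, m) + r $ (k, d) $ (l, m)) * snd z $ k)"
    and "partial (cotangent_basis (Inl d)) (coord_bracket_cotangent r w (Inr l) (Inl k)) z
      = - (\<Sum>j\<in>UNIV. snd z $ j * w $ (j, k) $ (l, d))"
    and "partial (cotangent_basis (Inr d)) (coord_bracket_cotangent r w (Inr l) (Inl k)) z
      = - (\<Sum>m\<in>UNIV. w $ (d, k) $ (l, m) * fst z $ m)"
    and "partial (cotangent_basis (Inl d)) (coord_bracket_cotangent r w (Inl k) (Inr l)) z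
      = (\<Sum>j\<in>UNIV. snd z $ j * w $ (j, k) $ (l, d))"
    and "partial (cotangent_basis (Inr d)) (coord_bracket_cotangent r w (Inl k) (Inr l)) z
      = (\<Sum>m\<in>UNIV. w $ (d, k) $ (l, m) * fst z $ m)"
  unfolding coord_bracket_has_derivative[THEN partial_eqI]
  by (simp_all add: sum.distrib sum_axis sum_axis_outer distrib_right mult.commute[of _ "w $ _ $ _"])

lemma coord_bracket_cotangent_skew:
  assumes skew: "\<And>j k l m. r $ (j, k) $ (l, m) = - r $ (k, j) $ (m, l)"
  shows "coord_bracket_cotangent r w a b z = - coord_bracket_cotangent r w b a z"
proof -
  have 1: "coord_bracket_cotangent r w (Inl i) (Inl j) z = - coord_bracket_cotangent r w (Inl j) (Inl i) z" for i j
    unfolding coord_bracket_cotangent_eq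
    by (subst sum.swap, subst skew) (simp add: sum_negf mult_ac)
  have 2: "coord_bracket_cotangent r w (Inr i) (Inr j) z = - coord_bracket_cotangent r w (Inr j) (Inr i) z" for i j
    unfolding coord_bracket_cotangent_eq
    by (subst sum.swap, subst skew) (simp add: sum_negf mult_ac)
  show ?thesis
    by (cases a; cases b; hypsubst; (rule 1 | rule 2 | simp add: coord_bracket_cotangent_eq(3,4)))
qed

section \<open>Jacobiators for each type of coordinate triple\<close>

lemma sum_UNIV_plus:
  "(\<Sum>d\<in>(UNIV :: ('a::finite + 'b::finite) set). f d) = (\<Sum>i\<in>UNIV. f (Inl i)) + (\<Sum>i\<in>UNIV. f (Inr i))"
  unfolding UNIV_Plus_UNIV[symmetric] by (subst sum.Plus) auto

text \<open>Leaves four types of triples to study: three positions, three momenta, and one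
  representative of each mixed type.\<close>

lemma jacobiator_cycle: "jacobiator e \<pi> b c a = jacobiator e \<pi> a b c"
  by (simp add: jacobiator_def fun_eq_iff add_ac)

text \<open>Position brackets have zero derivative along the momenta, so the Jacobiator of three
  positions on the cotangent space is the one on \<open>V\<close>, evaluated at
  \<open>fst z\<close>.\<close>

lemma jacobi_bracket_V_iff:
  assumes skew: "\<And>j k l m. r $ (j, k) $ (l, m) = - r $ (k, j) $ (m, l)"
  shows "jacobi_identity (bracket_V r) \<longleftrightarrow>
    (\<forall>a b c z. jacobiator cotangent_basis (coord_bracket_cotangent r w) (Inl a) (Inl b) (Inl c) z = 0)"
proof -
  have D: "(coord_bracket_V r a b has_derivative (\<lambda>v. \<Sum>l\<in>UNIV. \<Sum>m\<in>UNIV.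
      r $ (a, b) $ (l, m) * v $ l * x $ m + r $ (a, b) $ (l, m) * x $ l * v $ m)) (at x)" for a b x
    unfolding coord_bracket_V_def[abs_def] by (intro has_derivative_quadratic bounded_linear_vec_nth)
  have P: "partial (axis d 1) (coord_bracket_V r a b) x
      = (\<Sum>m\<in>UNIV. (r $ (a, b) $ (d, m) + r $ (a, b) $ (m, d)) * x $ m)" for a b d x
    unfolding D[THEN partial_eqI] by (simp add: sum.distrib sum_axis sum_axis_outer distrib_right)
  have V: "coord_bracket_V r a b (fst z) = coord_bracket_cotangent r w (Inl a) (Inl b) z" for a b z
    by (cases z) simp
  have "coord_bracket_V r a b x = - coord_bracket_V r b a x" for a b x
    using coord_bracket_cotangent_skew[OF skew, of w "Inl a" "Inl b" "(x, 0)"] by simp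
  from jacobi_identity_iff_jacobiator[where e = "\<lambda>j. axis j 1" and \<phi> = "\<lambda>a x. x $ a",
      OF this differentiableI[OF D] bounded_linear_vec_nth]
  have "jacobi_identity (bracket_V r) \<longleftrightarrow>
      (\<forall>a b c x. jacobiator (\<lambda>j. axis j 1) (coord_bracket_V r) a b c x = 0)"
    unfolding bracket_V_def by (simp add: axis_def)
  moreover have "jacobiator cotangent_basis (coord_bracket_cotangent r w) (Inl a) (Inl b) (Inl c) z
      = jacobiator (\<lambda>j. axis j 1) (coord_bracket_V r) a b c (fst z)" for a b c z
    by (simp add: jacobiator_def sum_UNIV_plus partial_coord_bracket P V del: cotangent_basis.simps)
  ultimately show ?thesis by simp
qed

lemma jacobi_bracket_dual_iff:
  assumes skew: "\<And>j k l m. r $ (j, k) $ (l, m) = - r $ (k, j) $ (m, l)"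
  shows "jacobi_identity (bracket_dual r) \<longleftrightarrow>
    (\<forall>a b c z. jacobiator cotangent_basis (coord_bracket_cotangent r w) (Inr a) (Inr b) (Inr c) z = 0)"
proof -
  have eq: "coord_bracket_dual r l m = (\<lambda>p. \<Sum>j\<in>UNIV. \<Sum>k\<in>UNIV. r $ (j, k) $ (l, m) * p $ j * p $ k)" for l m
    by (simp add: coord_bracket_dual_def fun_eq_iff mult_ac)
  have D: "(coord_bracket_dual r l m has_derivative (\<lambda>v. \<Sum>j\<in>UNIV. \<Sum>k\<in>UNIV.
      r $ (j, k) $ (l, m) * v $ j * p $ k + r $ (j, k) $ (l, m) * p $ j * v $ k)) (at p)" for l m p
    unfolding eq by (intro has_derivative_quadratic bounded_linear_vec_nth)
  have P: "partial (axis d 1) (coord_bracket_dual r l m) p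
      = (\<Sum>k\<in>UNIV. (r $ (d, k) $ (l, m) + r $ (k, d) $ (l, m)) * p $ k)" for l m d p
    unfolding D[THEN partial_eqI] by (simp add: sum.distrib sum_axis sum_axis_outer distrib_right)
  have V: "coord_bracket_dual r a b (snd z) = coord_bracket_cotangent r w (Inr a) (Inr b) z" for a b z
    by (cases z) simp
  have "coord_bracket_dual r a b p = - coord_bracket_dual r b a p" for a b p
    using coord_bracket_cotangent_skew[OF skew, of w "Inr a" "Inr b" "(0, p)"] by simp
  from jacobi_identity_iff_jacobiator[where e = "\<lambda>j. axis j 1" and \<phi> = "\<lambda>a p. p $ a",
      OF this differentiableI[OF D] bounded_linear_vec_nth]
  have "jacobi_identity (bracket_dual r) \<longleftrightarrow>
      (\<forall>a b c p. jacobiator (\<lambda>j. axis j 1) (coord_bracket_dual r) a b c p = 0)"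
    unfolding bracket_dual_def by (simp add: axis_def)
  moreover have "jacobiator cotangent_basis (coord_bracket_cotangent r w) (Inr a) (Inr b) (Inr c) z
      = jacobiator (\<lambda>j. axis j 1) (coord_bracket_dual r) a b c (snd z)" for a b c z
    by (simp add: jacobiator_def sum_UNIV_plus partial_coord_bracket P V del: cotangent_basis.simps)
  ultimately show ?thesis by simp
qed

lemma jacobi_bracket_cotangent_iff:
  assumes skew: "\<And>j k l m. r $ (j, k) $ (l, m) = - r $ (k, j) $ (m, l)"
  shows "jacobi_identity (bracket_cotangent r w) \<longleftrightarrow>
    (\<forall>a b c z. jacobiator cotangent_basis (coord_bracket_cotangent r w) a b c z = 0)"
  unfolding bracket_cotangent_def
proof (rule jacobi_identity_iff_jacobiator[where
      \<phi> = "\<lambda>a z. case a of Inl j \<Rightarrow> fst z $ j | Inr l \<Rightarrow> snd z $ l"])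
  show "coord_bracket_cotangent r w a b z = - coord_bracket_cotangent r w b a z" for a b z
    by (rule coord_bracket_cotangent_skew[OF skew])
  show "bounded_linear (\<lambda>z::(real ^ 'a) \<times> (real ^ 'a). case a of Inl j \<Rightarrow> fst z $ j | Inr l \<Rightarrow> snd z $ l)" for a
    by (cases a) (simp_all add: bounded_linear_coordinate)
  show "(case a of Inl j \<Rightarrow> fst (cotangent_basis b) $ j | Inr l \<Rightarrow> snd (cotangent_basis b) $ l)
      = (if a = b then 1 else 0)" for a b :: "'a + 'a"
    by (cases a; cases b) (auto simp: axis_def)
qed (rule coord_bracket_differentiable)

text \<open>Read in components, \<open>YB\<close> is exactly the cubic hypothesis of
  \<open>mixed_jacobiator_sum\<close>.\<close>

lemma jacobiator_pxx:
  fixes r w :: "'n::finite endo2"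
  assumes skew: "\<And>j k l m. r $ (j, k) $ (l, m) = - r $ (k, j) $ (m, l)"
    and YB: "commutator (place12 w) (place13 w) + commutator (place12 w) (place23 r)
      + commutator (place13 w) (place23 r) = 0"
  shows "jacobiator cotangent_basis (coord_bracket_cotangent r w) (Inr l) (Inl a) (Inl b) (x, p)
    = (\<Sum>m\<in>UNIV. (r $ (a, b) $ (l, m) - r $ (b, a) $ (l, m) + w $ (b, a) $ (l, m) - w $ (a, b) $ (l, m)) * x $ m)"
proof -
  have "(commutator (place12 w) (place13 w) + commutator (place12 w) (place23 r)
      + commutator (place13 w) (place23 r)) $ (j, a, b) $ (l, m, n) = 0" for j m n
    unfolding YB by simp
  note YB' = this[unfolded commutator_def vector_add_component vector_minus_component place_mult_nth]
  have px: "coord_bracket_px w c d (x, p)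
      = (if c = d then 1 else 0) - (\<Sum>j\<in>UNIV. \<Sum>m\<in>UNIV. p $ j * w $ (j, d) $ (c, m) * x $ m)" for c d
    by (simp add: coord_bracket_px_def)
  show ?thesis
    unfolding mixed_jacobiator_sum[where r = "\<lambda>j k l m. r $ (j, k) $ (l, m)"
      and w = "\<lambda>j k l m. w $ (j, k) $ (l, m)" and x = "\<lambda>m. x $ m" and p = "\<lambda>j. p $ j",
      OF skew YB', symmetric] px[symmetric] coord_bracket_V_def[symmetric]
    by (simp add: jacobiator_def sum_UNIV_plus partial_coord_bracket sum.distrib sum_negf
        del: cotangent_basis.simps)
qed

text \<open>The canonical transformation \<open>(x, p) \<mapsto> (p, - x)\<close> turns \<open>r\<close> into its transpose and \<open>w\<close> into
  minus its transpose with the two factors interchanged, and so reduces this case to the previous one.\<close>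

lemma jacobiator_ppx:
  fixes r w :: "'n::finite endo2"
  assumes skew: "\<And>j k l m. r $ (j, k) $ (l, m) = - r $ (k, j) $ (m, l)"
    and YB: "commutator (place12 r) (place13 w) + commutator (place12 r) (place23 w)
      + commutator (place13 w) (place23 w) = 0"
  shows "jacobiator cotangent_basis (coord_bracket_cotangent r w) (Inr l) (Inr m) (Inl k) (x, p)
    = - (\<Sum>n\<in>UNIV. (r $ (k, n) $ (l, m) - r $ (k, n) $ (m, l) - w $ (n, k) $ (l, m) + w $ (n, k) $ (m, l)) * p $ n)"
proof -
  define r' where "r' = (\<lambda>a b c d. r $ (c, d) $ (a, b))"
  define w' where "w' = (\<lambda>a b c d. - w $ (d, c) $ (b, a))"
  have "r' a b c d = - r' b a d c" for a b c d
    unfolding r'_def by (rule skew)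
  note mixed = mixed_jacobiator_sum[where r = r' and w = w' and x = "\<lambda>n. p $ n" and p = "\<lambda>n. - x $ n"
      and l = k and a = l and b = m, OF this]
  \<comment> \<open>The component is chosen by exchanging upper and lower indices and reversing the
    order of the three factors. The reversal also interchanges the two slots of \<open>r\<close>,
    which the skewness used below undoes.\<close>
  have "(commutator (place12 r) (place13 w) + commutator (place12 r) (place23 w)
      + commutator (place13 w) (place23 w)) $ (n, i, k) $ (m, l, j) = 0" for j i n
    unfolding YB by simp
  note YB' = this[unfolded commutator_def vector_add_component vector_minus_component place_mult_nth]
  have "(\<Sum>d\<in>UNIV. w' j l d m' * w' d m k n) - (\<Sum>d\<in>UNIV. w' j m d n * w' d l k m')
      + ((\<Sum>d\<in>UNIV. w' j l k d * r' d m m' n) - (\<Sum>d\<in>UNIV. r' l m d n * w' j d k m'))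
      + ((\<Sum>d\<in>UNIV. w' j m k d * r' l d m' n) - (\<Sum>d\<in>UNIV. r' l m m' d * w' j d k n)) = 0" for j m' n
  proof -
    have "r $ (n, m') $ (d, l) = - r $ (m', n) $ (l, d)" "r $ (n, m') $ (m, d) = - r $ (m', n) $ (d, m)"
      "r $ (d, m') $ (m, l) = - r $ (m', d) $ (l, m)" "r $ (n, d) $ (m, l) = - r $ (d, n) $ (l, m)" for d
      by (rule skew)+
    then show ?thesis
      using YB'[of n m' j] unfolding r'_def w'_def
      by (simp add: sum_negf mult.commute)
  qed
  note mixed = mixed[OF this]
  have px: "coord_bracket_px w c d (x, p)
      = (if d = c then 1 else 0) - (\<Sum>j\<in>UNIV. \<Sum>m\<in>UNIV. - x $ j * w' j c d m * p $ m)" for c d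
    unfolding coord_bracket_px_def w'_def by (subst sum.swap) (simp add: mult_ac eq_commute[of c])
  have dual: "coord_bracket_dual r c d p = (\<Sum>l\<in>UNIV. \<Sum>m\<in>UNIV. r' c d l m * p $ l * p $ m)" for c d
    by (simp add: coord_bracket_dual_def r'_def mult_ac)
  have inner: "(\<Sum>j\<in>UNIV. p $ j * w $ (j, c) $ (d, e)) = - (\<Sum>j\<in>UNIV. w' e d c j * p $ j)"
    "(\<Sum>j\<in>UNIV. w $ (e, c) $ (d, j) * x $ j) = (\<Sum>j\<in>UNIV. - x $ j * w' j d c e)"
    "(\<Sum>j\<in>UNIV. (r $ (e, j) $ (l, m) + r $ (j, e) $ (l, m)) * p $ j)
      = (\<Sum>j\<in>UNIV. (r' l m e j + r' l m j e) * p $ j)" for c d e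
    by (simp_all add: r'_def w'_def sum_negf mult.commute)
  have "jacobiator cotangent_basis (coord_bracket_cotangent r w) (Inr l) (Inr m) (Inl k) (x, p)
    = - (\<Sum>n\<in>UNIV. (r' l m k n - r' m l k n + w' m l k n - w' l m k n) * p $ n)"
    unfolding mixed[symmetric] px[symmetric] dual[symmetric]
    by (simp add: jacobiator_def sum_UNIV_plus partial_coord_bracket inner sum.distrib sum_negf del: cotangent_basis.simps)
  then show ?thesis by (simp add: r'_def w'_def)
qed

theorem theorem6p4:
  fixes \<gg> :: "(real ^ 'n::finite ^ 'n) set"
    and r s :: "real ^ ('n \<times> 'n) ^ ('n \<times> 'n)"
  assumes "lie_subalgebra \<gg>"
    and "classical_r_matrix \<gg> r"
    and "jacobi_identity (bracket_V r)"
    and "jacobi_identity (bracket_dual r)"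
    and "s \<in> tensor_square \<gg>"
    and "symmetric_tensor s"
    and "invariant2 \<gg> s"
    and "classical_Yang_Baxter (r + s)"
  shows "(jacobi_identity (bracket_cotangent r (r + s)) \<longleftrightarrow>
            (\<forall>j k l m. s $ (j, k) $ (l, m) = s $ (k, j) $ (l, m))) \<and>
         (\<forall>lam::real.
            jacobi_identity (bracket_cotangent r (r + s + lam *\<^sub>R (\<one> \<otimes> \<one>))) \<longleftrightarrow>
            (\<forall>j k l m. (s + lam *\<^sub>R (\<one> \<otimes> \<one>)) $ (j, k) $ (l, m)
                     = (s + lam *\<^sub>R (\<one> \<otimes> \<one>)) $ (k, j) $ (l, m)))"
proof -
  have r: "r \<in> exterior_square \<gg>"
    using assms(2) by (simp add: classical_r_matrix_def)
  note skew = exterior_square_skew[OF r]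
  \<comment> \<open>Both parts at once; the first is the case \<open>lam = 0\<close>.\<close>
  have main: "jacobi_identity (bracket_cotangent r (r + s + lam *\<^sub>R (\<one> \<otimes> \<one>))) \<longleftrightarrow>
      (\<forall>j k l m. (s + lam *\<^sub>R (\<one> \<otimes> \<one>)) $ (j, k) $ (l, m) = (s + lam *\<^sub>R (\<one> \<otimes> \<one>)) $ (k, j) $ (l, m))"
    for lam :: real
  proof -
    define t where "t = s + lam *\<^sub>R (\<one> \<otimes> \<one>)"
    let ?w = "r + s + lam *\<^sub>R (\<one> \<otimes> \<one>)"
    define J where "J = jacobiator cotangent_basis (coord_bracket_cotangent r ?w)"
    have w: "?w $ i $ j = r $ i $ j + t $ i $ j" for i j
      by (simp add: t_def)
    note YB = Yang_Baxter_variants[OF r assms(5,7,8), of lam]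
    have t_sym: "t $ (j, k) $ (l, m) = t $ (k, j) $ (m, l)" for j k l m
      using assms(6) by (auto simp: t_def symmetric_tensor_def tensor_def)
    have pxx: "J (Inr l) (Inl a) (Inl b) (x, p)
        = (\<Sum>m\<in>UNIV. (t $ (b, a) $ (l, m) - t $ (a, b) $ (l, m)) * x $ m)" for l a b x p
      unfolding J_def jacobiator_pxx[OF skew YB(1)] w by simp
    \<comment> \<open>The \<open>r\<close> terms cancel by skewness, and the symmetry of
      \<open>t\<close> turns an exchange of lower indices into one of upper indices. Both mixed
      types thus give the same obstruction.\<close>
    have ppx: "J (Inr l) (Inr m) (Inl k) (x, p)
        = (\<Sum>n\<in>UNIV. (t $ (n, k) $ (l, m) - t $ (k, n) $ (l, m)) * p $ n)" for l m k x p
      unfolding J_def jacobiator_ppx[OF skew YB(2)] w sum_negf[symmetric]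
      using skew[of k _ l m] skew[of k _ m l] t_sym[of _ k m l]
      by (intro sum.cong refl) (simp add: algebra_simps)
    have "(\<forall>a b c z. J a b c z = 0) \<longleftrightarrow> (\<forall>j k l m. t $ (j, k) $ (l, m) = t $ (k, j) $ (l, m))"
    proof
      assume 0: "\<forall>a b c z. J a b c z = 0"
      show "\<forall>j k l m. t $ (j, k) $ (l, m) = t $ (k, j) $ (l, m)"
      proof (intro allI)
        fix j k l m
        \<comment> \<open>Evaluation at a basis vector extracts one coefficient of the linear
          form.\<close>
        have "J (Inr l) (Inl k) (Inl j) (axis m 1, 0) = t $ (j, k) $ (l, m) - t $ (k, j) $ (l, m)"
          unfolding pxx by (rule sum_axis)
        then show "t $ (j, k) $ (l, m) = t $ (k, j) $ (l, m)" using 0 by simp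
      qed
    next
      assume t: "\<forall>j k l m. t $ (j, k) $ (l, m) = t $ (k, j) $ (l, m)"
      have pxx0: "J (Inr l) (Inl a) (Inl b) z = 0" for l a b z
        using t by (cases z) (simp add: pxx)
      have ppx0: "J (Inr l) (Inr m) (Inl k) z = 0" for l m k z
        using t by (cases z) (simp add: ppx)
      have cycle: "J b c a z = J a b c z" for a b c z
        unfolding J_def by (rule fun_cong[OF jacobiator_cycle])
      have rotated: "J (Inl a) (Inl b) (Inr l) z = 0" "J (Inl b) (Inr l) (Inl a) z = 0"
        "J (Inr m) (Inl k) (Inr l) z = 0" "J (Inl k) (Inr l) (Inr m) z = 0" for a b k l m z
        by (rule trans[OF cycle pxx0] trans[OF cycle trans[OF cycle pxx0]]
            trans[OF cycle ppx0] trans[OF cycle trans[OF cycle ppx0]])+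
      have pure: "J (Inl a) (Inl b) (Inl c) z = 0" "J (Inr a) (Inr b) (Inr c) z = 0" for a b c z
        using assms(3,4) unfolding J_def jacobi_bracket_V_iff[OF skew, of ?w]
          jacobi_bracket_dual_iff[OF skew, of ?w] by blast+
      \<comment> \<open>Eight cases: two pure ones from the hypotheses on \<open>V\<close> and its
        dual, and three rotations of each mixed type.\<close>
      have "J a b c z = 0" for a b c z
        by (cases a; cases b; cases c) (simp_all only: pure pxx0 ppx0 rotated)
      then show "\<forall>a b c z. J a b c z = 0" by blast
    qed
    then show ?thesis
      unfolding J_def t_def jacobi_bracket_cotangent_iff[OF skew] .
  qed
  then show ?thesis using main[of 0] by simp
qed

end
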